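(* Let $\phi\colon\mathbb{D}\to\mathbb{D}$ be an analytic self-map and $0<p<\infty$. If there exists $w\in H^2$, $w\not\equiv0$, such that $M_wC_\phi\colon f\mapsto w\,(f\circ\phi)$ is a bounded operator on $H^2$ belonging to $S_p(H^2)$, then there exists $\tilde w\in H^2$, $\tilde w\not\equiv0$, such that $M_{\tilde w}C_\phi$ is a Hilbert–Schmidt operator on $H^2$.
   Context: $\mathbb{D}$ is the open unit disk, $H^2$ the Hardy space. $S_p(H^2)$, $p>0$, is the Schatten class of compact operators $T$ on $H^2$ with $\sum_n s_n(T)^p<\infty$ ($s_n$ the singular numbers). *)

theory Defs
  imports "HOL-Complex_Analysis.Complex_Analysis"
begin

definition taylor_coeff :: "(complex \<Rightarrow> complex) \<Rightarrow> nat \<Rightarrow> complex" where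
  "taylor_coeff f n = (deriv ^^ n) f 0 / of_nat (fact n)"

definition H2 :: "(complex \<Rightarrow> complex) set" where
  "H2 = {f. f holomorphic_on ball 0 1 \<and> summable (\<lambda>n. (cmod (taylor_coeff f n))\<^sup>2)}"

definition h2_norm :: "(complex \<Rightarrow> complex) \<Rightarrow> real" where
  "h2_norm f = sqrt (\<Sum>n. (cmod (taylor_coeff f n))\<^sup>2)"

text \<open>Bounded linear operators on H^2 (operators act on functions; only values on the disk matter).\<close>
definition h2_bounded_op :: "((complex \<Rightarrow> complex) \<Rightarrow> (complex \<Rightarrow> complex)) \<Rightarrow> bool" where
  "h2_bounded_op T \<longleftrightarrow>
     (\<forall>f\<in>H2. T f \<in> H2) \<and>
     (\<forall>f\<in>H2. \<forall>g\<in>H2. \<forall>a::complex. \<forall>z\<in>ball 0 1.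
         T (\<lambda>x. a * f x + g x) z = a * T f z + T g z) \<and>
     (\<exists>C. \<forall>f\<in>H2. h2_norm (T f) \<le> C * h2_norm f)"

definition h2_op_norm :: "((complex \<Rightarrow> complex) \<Rightarrow> (complex \<Rightarrow> complex)) \<Rightarrow> real" where
  "h2_op_norm T = Sup {h2_norm (T f) | f. f \<in> H2 \<and> h2_norm f \<le> 1}"

definition h2_rank_le :: "((complex \<Rightarrow> complex) \<Rightarrow> (complex \<Rightarrow> complex)) \<Rightarrow> nat \<Rightarrow> bool" where
  "h2_rank_le R n \<longleftrightarrow>
     (\<exists>b :: nat \<Rightarrow> complex \<Rightarrow> complex. \<forall>f\<in>H2. \<exists>c :: nat \<Rightarrow> complex.
        \<forall>z\<in>ball 0 1. R f z = (\<Sum>i<n. c i * b i z))"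

text \<open>Singular numbers s_n(T) (n = 0,1,...), via the approximation-number formula
  s_n(T) = inf { ||T - R|| : R of rank at most n }, valid for operators on Hilbert space.\<close>
definition singular_num :: "((complex \<Rightarrow> complex) \<Rightarrow> (complex \<Rightarrow> complex)) \<Rightarrow> nat \<Rightarrow> real" where
  "singular_num T n = Inf {h2_op_norm (\<lambda>f z. T f z - R f z) | R. h2_bounded_op R \<and> h2_rank_le R n}"

text \<open>Schatten class S_p(H^2): bounded T with sum s_n(T)^p finite (this forces s_n \<rightarrow> 0,
  hence compactness).\<close>
definition schatten :: "real \<Rightarrow> ((complex \<Rightarrow> complex) \<Rightarrow> (complex \<Rightarrow> complex)) \<Rightarrow> bool" where
  "schatten p T \<longleftrightarrow> h2_bounded_op T \<and> summable (\<lambda>n. singular_num T n powr p)"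

text \<open>Hilbert-Schmidt: sum of ||T e_n||^2 over the orthonormal basis e_n = z^n is finite.\<close>
definition hilbert_schmidt :: "((complex \<Rightarrow> complex) \<Rightarrow> (complex \<Rightarrow> complex)) \<Rightarrow> bool" where
  "hilbert_schmidt T \<longleftrightarrow> h2_bounded_op T \<and> summable (\<lambda>n. (h2_norm (T (\<lambda>z. z ^ n)))\<^sup>2)"

definition wcomp :: "(complex \<Rightarrow> complex) \<Rightarrow> (complex \<Rightarrow> complex) \<Rightarrow> (complex \<Rightarrow> complex) \<Rightarrow> (complex \<Rightarrow> complex)" where
  "wcomp w \<phi> f = (\<lambda>z. w z * f (\<phi> z))"

end

theory Submission
  imports Defs
begin

text \<open>Write \<open>T\<close> for the weighted composition operator and \<open>e n\<close> for the monomial of degree \<open>n\<close>.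
  An operator of rank \<open>N\<close> and norm \<open>K\<close> has squared Hilbert--Schmidt norm at most \<open>N * K\<^sup>2\<close>. Hence, if the
  approximation numbers of \<open>T\<close> decay polynomially, the sum of \<open>\<parallel>T (e n)\<parallel>\<^sup>2\<close> over \<open>n < M\<close> is bounded by a power
  of \<open>M\<close> with exponent below one. A suitable weighted sum of the functions
  \<open>\<bar>T (e n)\<bar>\<^sup>2 = \<bar>w\<bar>\<^sup>2 * \<bar>\<phi>\<bar> ^ (2 * n)\<close> then still has an integrable boundary value and
  dominates \<open>\<bar>w\<bar>\<^sup>2 / (1 - \<bar>\<phi>\<bar>\<^sup>2) powr \<beta>\<close> for some \<open>\<beta> > 0\<close>, so there is a holomorphic \<open>G\<close> on the disk whose
  real part is a harmonic majorant of this function. For \<open>k\<close> large, \<open>w' = w ^ k * exp (- G)\<close> satisfies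
  \<open>\<bar>w'\<bar>\<^sup>2 \<le> C * (1 - \<bar>\<phi>\<bar>\<^sup>2)\<close> pointwise on the disk, which makes the new operator Hilbert--Schmidt.\<close>

section \<open>Taylor coefficients and the Hardy space\<close>

lemma taylor_coeff_cong:
  assumes "\<And>z. z \<in> ball 0 1 \<Longrightarrow> f z = g z"
  shows "taylor_coeff f n = taylor_coeff g n"
proof -
  have "eventually (\<lambda>z. f z = g z) (nhds (0::complex))"
    by (rule eventually_nhds_in_open[of "ball 0 1" "0::complex", THEN eventually_mono]) (auto intro: assms)
  then show ?thesis
    unfolding taylor_coeff_def using higher_deriv_cong_ev[of f g 0 0 n] by simp
qed

lemma taylor_coeff_add:
  assumes "f holomorphic_on ball 0 1" "g holomorphic_on ball 0 1"
  shows "taylor_coeff (\<lambda>z. f z + g z) n = taylor_coeff f n + taylor_coeff g n"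
  using higher_deriv_add[OF assms, of 0 n] by (simp add: taylor_coeff_def add_divide_distrib)

lemma taylor_coeff_cmult:
  assumes "f holomorphic_on ball 0 1"
  shows "taylor_coeff (\<lambda>z. c * f z) n = c * taylor_coeff f n"
  using higher_deriv_cmult[OF assms, of 0 n c] by (simp add: taylor_coeff_def)

lemma taylor_coeff_zero [simp]: "taylor_coeff (\<lambda>z. 0) n = 0"
  by (simp add: taylor_coeff_def)

lemma taylor_coeff_sum:
  assumes "\<And>i. i \<in> I \<Longrightarrow> f i holomorphic_on ball 0 1"
  shows "taylor_coeff (\<lambda>z. \<Sum>i\<in>I. f i z) n = (\<Sum>i\<in>I. taylor_coeff (f i) n)"
  using assms
proof (induction I rule: infinite_finite_induct)
  case (insert x F)
  have "(\<lambda>z. \<Sum>i\<in>F. f i z) holomorphic_on ball 0 1"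
    using insert by (intro holomorphic_intros) auto
  then show ?case using insert by (simp add: taylor_coeff_add)
qed auto

lemma taylor_coeff_power: "taylor_coeff (\<lambda>z. z ^ m) n = (if n = m then 1 else 0)"
proof -
  have "(\<lambda>z::complex. z ^ m) has_fps_expansion fps_X ^ m"
    by (rule has_fps_expansion_fps_X_power)
  from fps_nth_fps_expansion[OF this, of n] show ?thesis
    by (simp add: taylor_coeff_def fps_X_power_nth)
qed

lemma taylor_coeff_polynomial:
  "taylor_coeff (\<lambda>z. \<Sum>m<M. t m * z ^ m) n = (if n < M then t n else 0)"
proof -
  have "taylor_coeff (\<lambda>z. \<Sum>m<M. t m * z ^ m) n = (\<Sum>m<M. t m * (if n = m then 1 else 0))"
    by (subst taylor_coeff_sum) 
      (auto intro!: holomorphic_intros sum.cong simp: taylor_coeff_cmult taylor_coeff_power holomorphic_intros)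
  then show ?thesis by (simp add: if_distrib cong: if_cong)
qed

lemma taylor_sums:
  assumes "f holomorphic_on ball 0 1" "z \<in> ball 0 1"
  shows "(\<lambda>n. taylor_coeff f n * z ^ n) sums f z"
  using holomorphic_power_series[OF assms] by (simp add: taylor_coeff_def)

lemma H2_holomorphic: "f \<in> H2 \<Longrightarrow> f holomorphic_on ball 0 1"
  by (simp add: H2_def)

lemma H2_summable: "f \<in> H2 \<Longrightarrow> summable (\<lambda>n. (cmod (taylor_coeff f n))\<^sup>2)"
  by (simp add: H2_def)

lemma h2_norm_cong:
  assumes "\<And>z. z \<in> ball 0 1 \<Longrightarrow> f z = g z"
  shows "h2_norm f = h2_norm g"
  unfolding h2_norm_def using taylor_coeff_cong[OF assms] by simp

lemma h2_norm_nonneg: "f \<in> H2 \<Longrightarrow> 0 \<le> h2_norm f"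
  unfolding h2_norm_def by (simp add: suminf_nonneg H2_summable)

lemma h2_norm_square:
  assumes "f \<in> H2"
  shows "(h2_norm f)\<^sup>2 = (\<Sum>n. (cmod (taylor_coeff f n))\<^sup>2)"
  unfolding h2_norm_def by (simp add: suminf_nonneg H2_summable assms)

lemma sum_taylor_coeff_le:
  assumes "f \<in> H2"
  shows "(\<Sum>n<L. (cmod (taylor_coeff f n))\<^sup>2) \<le> (h2_norm f)\<^sup>2"
  unfolding h2_norm_square[OF assms] by (rule sum_le_suminf) (auto simp: H2_summable assms)

text \<open>Partial sums of a nonnegative series are monotone, so a uniform bound gives both
  convergence and the bound for the limit. This serves estimates that control only finitely many
  coefficients at a time.\<close>

lemma H2_I_bounded:
  assumes "f holomorphic_on ball 0 1"
    and "\<And>L. (\<Sum>n<L. (cmod (taylor_coeff f n))\<^sup>2) \<le> B"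
  shows "f \<in> H2" "(h2_norm f)\<^sup>2 \<le> B"
proof -
  have "summable (\<lambda>n. (cmod (taylor_coeff f n))\<^sup>2)"
    by (rule bounded_imp_summable[of _ B]) (use assms(2)[of "Suc _"] in \<open>auto simp: lessThan_Suc_atMost\<close>)
  then show "f \<in> H2" using assms(1) by (simp add: H2_def)
  then show "(h2_norm f)\<^sup>2 \<le> B"
    using assms(2) by (simp add: h2_norm_square suminf_le_const H2_summable)
qed

lemma cmod_add_square_le: "(cmod (a + b))\<^sup>2 \<le> 2 * (cmod a)\<^sup>2 + 2 * (cmod b)\<^sup>2"
proof -
  have "(cmod (a + b))\<^sup>2 \<le> (cmod a + cmod b)\<^sup>2"
    by (simp add: norm_triangle_ineq power_mono)
  also have "\<dots> \<le> 2 * (cmod a)\<^sup>2 + 2 * (cmod b)\<^sup>2"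
    using zero_le_power2[of "cmod a - cmod b"] by (simp add: power2_eq_square algebra_simps)
  finally show ?thesis .
qed

text \<open>The factor 2 comes from summing \<open>cmod_add_square_le\<close> over the coefficients.
  Later arguments need only some finite constant.\<close>

lemma H2_add:
  assumes "f \<in> H2" "g \<in> H2"
  shows "(\<lambda>z. f z + g z) \<in> H2"
    and "(h2_norm (\<lambda>z. f z + g z))\<^sup>2 \<le> 2 * (h2_norm f)\<^sup>2 + 2 * (h2_norm g)\<^sup>2"
proof -
  have hol: "(\<lambda>z. f z + g z) holomorphic_on ball 0 1"
    using assms H2_holomorphic by (intro holomorphic_intros) auto
  have "(\<Sum>n<L. (cmod (taylor_coeff (\<lambda>z. f z + g z) n))\<^sup>2) \<le> 2 * (h2_norm f)\<^sup>2 + 2 * (h2_norm g)\<^sup>2" for L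
  proof -
    have "(\<Sum>n<L. (cmod (taylor_coeff (\<lambda>z. f z + g z) n))\<^sup>2)
      \<le> (\<Sum>n<L. 2 * (cmod (taylor_coeff f n))\<^sup>2 + 2 * (cmod (taylor_coeff g n))\<^sup>2)"
      by (intro sum_mono) (simp add: taylor_coeff_add assms H2_holomorphic cmod_add_square_le)
    also have "\<dots> = 2 * (\<Sum>n<L. (cmod (taylor_coeff f n))\<^sup>2) + 2 * (\<Sum>n<L. (cmod (taylor_coeff g n))\<^sup>2)"
      by (simp add: sum.distrib sum_distrib_left)
    also have "\<dots> \<le> 2 * (h2_norm f)\<^sup>2 + 2 * (h2_norm g)\<^sup>2"
      using sum_taylor_coeff_le[OF assms(1), of L] sum_taylor_coeff_le[OF assms(2), of L] by simp
    finally show ?thesis .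
  qed
  from H2_I_bounded[OF hol this]
  show "(\<lambda>z. f z + g z) \<in> H2"
    and "(h2_norm (\<lambda>z. f z + g z))\<^sup>2 \<le> 2 * (h2_norm f)\<^sup>2 + 2 * (h2_norm g)\<^sup>2" .
qed

lemma H2_cmult:
  assumes "f \<in> H2"
  shows "(\<lambda>z. c * f z) \<in> H2" and "h2_norm (\<lambda>z. c * f z) = cmod c * h2_norm f"
proof -
  have coeff: "taylor_coeff (\<lambda>z. c * f z) n = c * taylor_coeff f n" for n
    by (simp add: taylor_coeff_cmult H2_holomorphic assms)
  show "(\<lambda>z. c * f z) \<in> H2"
    using assms by (auto simp: H2_def taylor_coeff_cmult norm_mult power_mult_distrib intro!: holomorphic_intros)
  show "h2_norm (\<lambda>z. c * f z) = cmod c * h2_norm f"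
    unfolding h2_norm_def coeff norm_mult power_mult_distrib
    by (simp add: suminf_mult H2_summable assms real_sqrt_mult)
qed

lemma H2_zero: "(\<lambda>z. 0) \<in> H2" and h2_norm_zero: "h2_norm (\<lambda>z. 0) = 0"
  by (simp_all add: H2_def h2_norm_def)

lemma H2_diff:
  assumes "f \<in> H2" "g \<in> H2"
  shows "(\<lambda>z. f z - g z) \<in> H2"
    and "(h2_norm (\<lambda>z. f z - g z))\<^sup>2 \<le> 2 * (h2_norm f)\<^sup>2 + 2 * (h2_norm g)\<^sup>2"
  using H2_add[OF assms(1) H2_cmult(1)[OF assms(2), of "-1"]] H2_cmult(2)[OF assms(2), of "-1"]
  by simp_all

lemma H2_polynomial:
  shows "(\<lambda>z. \<Sum>m<M. t m * z ^ m) \<in> H2"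
    and "(h2_norm (\<lambda>z. \<Sum>m<M. t m * z ^ m))\<^sup>2 = (\<Sum>m<M. (cmod (t m))\<^sup>2)"
proof -
  have s: "(\<lambda>n. (cmod (taylor_coeff (\<lambda>z. \<Sum>m<M. t m * z ^ m) n))\<^sup>2) sums (\<Sum>m<M. (cmod (t m))\<^sup>2)"
    using sums_If_finite_set[of "{..<M}" "\<lambda>n. (cmod (t n))\<^sup>2"]
    by (simp add: taylor_coeff_polynomial if_distrib[of cmod] if_distrib[of "\<lambda>x. x\<^sup>2"] cong: if_cong)
  have "(\<lambda>z. \<Sum>m<M. t m * z ^ m) holomorphic_on ball 0 1"
    by (intro holomorphic_intros)
  with s show H: "(\<lambda>z. \<Sum>m<M. t m * z ^ m) \<in> H2"
    by (auto simp: H2_def sums_iff)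
  show "(h2_norm (\<lambda>z. \<Sum>m<M. t m * z ^ m))\<^sup>2 = (\<Sum>m<M. (cmod (t m))\<^sup>2)"
    using s by (simp add: h2_norm_square[OF H] sums_iff)
qed

lemma H2_power: "(\<lambda>z. z ^ n) \<in> H2" and h2_norm_power: "h2_norm (\<lambda>z. z ^ n) = 1"
proof -
  have s: "(\<lambda>k. (cmod (taylor_coeff (\<lambda>z. z ^ n) k))\<^sup>2) sums 1"
    using sums_single[of n "\<lambda>_. 1::real"]
    by (simp add: taylor_coeff_power if_distrib[of cmod] if_distrib[of "\<lambda>x. x\<^sup>2"] cong: if_cong)
  show "(\<lambda>z. z ^ n) \<in> H2"
    using s by (auto simp: H2_def sums_iff intro!: holomorphic_intros)
  show "h2_norm (\<lambda>z. z ^ n) = 1"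
    using s by (simp add: h2_norm_def sums_iff)
qed

text \<open>Cauchy-Schwarz between the coefficients of \<open>f\<close> and the powers of
  \<open>z\<close>; the geometric series is the squared norm of the reproducing kernel at
  \<open>z\<close>. It is applied below at the points \<open>\<phi> z\<close>.\<close>

lemma H2_pointwise_bound:
  assumes "f \<in> H2" "z \<in> ball 0 1"
  shows "(cmod (f z))\<^sup>2 * (1 - (cmod z)\<^sup>2) \<le> (h2_norm f)\<^sup>2"
proof -
  have z: "cmod z < 1" "(cmod z)\<^sup>2 < 1"
    using assms(2) by (auto simp: abs_square_less_1)
  have bound: "(cmod (\<Sum>n<L. taylor_coeff f n * z ^ n))\<^sup>2 \<le> (h2_norm f)\<^sup>2 / (1 - (cmod z)\<^sup>2)" for L
  proof -
    have "(cmod (\<Sum>n<L. taylor_coeff f n * z ^ n))\<^sup>2 \<le> (\<Sum>n<L. cmod (taylor_coeff f n) * cmod z ^ n)\<^sup>2"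
      by (rule power_mono) (auto intro!: sum_norm_le simp: norm_mult norm_power)
    also have "\<dots> \<le> (\<Sum>n<L. (cmod (taylor_coeff f n))\<^sup>2) * (\<Sum>n<L. (cmod z ^ n)\<^sup>2)"
      by (rule Cauchy_Schwarz_ineq_sum)
    also have "\<dots> \<le> (h2_norm f)\<^sup>2 * (1 / (1 - (cmod z)\<^sup>2))"
    proof (rule mult_mono)
      have "(\<Sum>n<L. (cmod z ^ n)\<^sup>2) = (\<Sum>n<L. ((cmod z)\<^sup>2) ^ n)"
        by (simp add: power_mult[symmetric] mult.commute)
      also have "\<dots> \<le> (\<Sum>n. ((cmod z)\<^sup>2) ^ n)"
        using z by (intro sum_le_suminf summable_geometric) auto
      also have "\<dots> = 1 / (1 - (cmod z)\<^sup>2)"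
        using z by (intro suminf_geometric) auto
      finally show "(\<Sum>n<L. (cmod z ^ n)\<^sup>2) \<le> 1 / (1 - (cmod z)\<^sup>2)" .
    qed (auto simp: sum_taylor_coeff_le assms intro: sum_nonneg)
    finally show ?thesis by simp
  qed
  have "(\<lambda>L. (cmod (\<Sum>n<L. taylor_coeff f n * z ^ n))\<^sup>2) \<longlonglongrightarrow> (cmod (f z))\<^sup>2"
    using taylor_sums[OF H2_holomorphic[OF assms(1)] assms(2)]
    by (auto simp: sums_def intro!: tendsto_intros)
  then have "(cmod (f z))\<^sup>2 \<le> (h2_norm f)\<^sup>2 / (1 - (cmod z)\<^sup>2)"
    by (rule LIMSEQ_le_const2) (use bound in auto)
  then show ?thesis using z by (simp add: field_simps)
qed

section \<open>Bounded holomorphic functions are in the Hardy space\<close>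

text \<open>Cauchy's formula for the n-th derivative, written in the circle parameter: the
  derivative of the path is \<open>2 * pi * \<i>\<close> times the path, which cancels the prefactor
  and one power in the denominator.\<close>

lemma circle_mean_taylor_coeff:
  assumes "f holomorphic_on ball 0 1" "0 < r" "r < 1"
  shows "((\<lambda>t. f (circlepath 0 r t) / circlepath 0 r t ^ n) has_integral taylor_coeff f n) {0..1}"
proof -
  have sub: "cball 0 r \<subseteq> ball (0::complex) 1" "ball 0 r \<subseteq> ball (0::complex) 1"
    using assms by auto
  have "continuous_on (cball 0 r) f"
    using assms(1) sub holomorphic_on_imp_continuous_on holomorphic_on_subset by blast
  moreover have "f holomorphic_on ball 0 r"
    using assms(1) sub holomorphic_on_subset by blast
  ultimately have "((\<lambda>u. f u / (u - 0) ^ Suc n) has_contour_integral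
      ((2 * pi * \<i>) / fact n * (deriv ^^ n) f 0)) (circlepath 0 r)"
    using assms by (intro Cauchy_has_contour_integral_higher_derivative_circlepath) auto
  then have "((\<lambda>t. 1 / (2 * pi * \<i>) * (f (circlepath 0 r t) / (circlepath 0 r t - 0) ^ Suc n *
      vector_derivative (circlepath 0 r) (at t))) has_integral
      1 / (2 * pi * \<i>) * ((2 * pi * \<i>) / fact n * (deriv ^^ n) f 0)) {0..1}"
    unfolding has_contour_integral by (intro has_integral_mult_right)
  moreover have "1 / (2 * pi * \<i>) * ((2 * pi * \<i>) / fact n * (deriv ^^ n) f 0) = taylor_coeff f n"
    by (simp add: taylor_coeff_def)
  moreover have "1 / (2 * pi * \<i>) * (f (circlepath 0 r t) / (circlepath 0 r t - 0) ^ Suc n *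
      vector_derivative (circlepath 0 r) (at t)) = f (circlepath 0 r t) / circlepath 0 r t ^ n" for t
    using assms unfolding vector_derivative_circlepath by (simp add: circlepath field_simps)
  ultimately show ?thesis by simp
qed

text \<open>Bessel's inequality on the circle of radius \<open>r\<close>: compare \<open>f\<close>
  with its Taylor polynomial \<open>P\<close> of degree below \<open>L\<close>. The means of
  \<open>f * cnj P\<close> and of \<open>P * cnj P\<close> are the same number
  \<open>S\<close>.\<close>

lemma Bessel_circle:
  assumes f: "f holomorphic_on ball 0 1" and r: "0 < r" "r < 1"
  shows "(\<Sum>n<L. (cmod (taylor_coeff f n))\<^sup>2 * r ^ (2 * n))
      \<le> integral {0..1} (\<lambda>t. (cmod (f (circlepath 0 r t)))\<^sup>2)"
    and "(\<lambda>t. (cmod (f (circlepath 0 r t)))\<^sup>2) integrable_on {0..1}"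
proof -
  define a where "a = taylor_coeff f"
  define P where "P = (\<lambda>z. \<Sum>n<L. a n * z ^ n)"
  define \<gamma> where "\<gamma> = circlepath 0 r"
  have norm_\<gamma>: "cmod (\<gamma> t) = r" for t
    using r by (simp add: \<gamma>_def circlepath norm_mult)
  \<comment> \<open>On the circle \<open>cnj z = r^2 / z\<close>, so a conjugated power becomes a
    negative power, to which the coefficient formula applies.\<close>
  have \<gamma>_cnj: "cnj (\<gamma> t) ^ n = of_real (r ^ (2 * n)) / \<gamma> t ^ n" for t n
  proof -
    have "\<gamma> t \<noteq> 0" using norm_\<gamma>[of t] r by auto
    moreover have "(\<gamma> t * cnj (\<gamma> t)) ^ n = of_real (r ^ (2 * n))"
      unfolding complex_norm_square[symmetric] norm_\<gamma> by (simp add: power_mult)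
    ultimately show ?thesis by (simp add: field_simps power_mult_distrib)
  qed
  have int: "((\<lambda>t. g (\<gamma> t) * cnj (P (\<gamma> t))) has_integral
      (\<Sum>n<L. cnj (a n) * of_real (r ^ (2 * n)) * taylor_coeff g n)) {0..1}"
    if "g holomorphic_on ball 0 1" for g
  proof -
    have "((\<lambda>t. \<Sum>n<L. cnj (a n) * of_real (r ^ (2 * n)) * (g (\<gamma> t) / \<gamma> t ^ n)) has_integral
      (\<Sum>n<L. cnj (a n) * of_real (r ^ (2 * n)) * taylor_coeff g n)) {0..1}"
      unfolding \<gamma>_def
      by (intro has_integral_sum has_integral_mult_right circle_mean_taylor_coeff that r) auto
    moreover have "(\<Sum>n<L. cnj (a n) * of_real (r ^ (2 * n)) * (g (\<gamma> t) / \<gamma> t ^ n)) =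
        g (\<gamma> t) * cnj (P (\<gamma> t))" for t
      by (simp add: P_def cnj_sum \<gamma>_cnj sum_distrib_left mult_ac)
    ultimately show ?thesis by simp
  qed
  define S where "S = (\<Sum>n<L. (cmod (a n))\<^sup>2 * r ^ (2 * n))"
  have coeffs: "(\<Sum>n<L. cnj (a n) * of_real (r ^ (2 * n)) * b n) = of_real S"
    if "\<And>n. n < L \<Longrightarrow> b n = a n" for b
    unfolding S_def of_real_sum
  proof (rule sum.cong)
    fix n assume "n \<in> {..<L}"
    then have "b n = a n" using that by simp
    then show "cnj (a n) * of_real (r ^ (2 * n)) * b n = of_real ((cmod (a n))\<^sup>2 * r ^ (2 * n))"
      using complex_norm_square[of "a n"] by (simp add: mult_ac)
  qed simp
  have holP: "P holomorphic_on ball 0 1"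
    unfolding P_def by (intro holomorphic_intros)
  have intf: "((\<lambda>t. f (\<gamma> t) * cnj (P (\<gamma> t))) has_integral of_real S) {0..1}"
    using int[OF f] coeffs[of "taylor_coeff f"] by (simp add: a_def)
  have intP: "((\<lambda>t. P (\<gamma> t) * cnj (P (\<gamma> t))) has_integral of_real S) {0..1}"
    using int[OF holP] coeffs[of "taylor_coeff P"] by (simp add: P_def taylor_coeff_polynomial)
  \<comment> \<open>This integrand has mean \<open>2 * S - S = S\<close>, and it lies below the
    squared modulus of \<open>f\<close> because the squared modulus of \<open>f - P\<close> is
    nonnegative.\<close>
  have low: "((\<lambda>t. 2 * Re (f (\<gamma> t) * cnj (P (\<gamma> t))) - Re (P (\<gamma> t) * cnj (P (\<gamma> t)))) has_integral
      (2 * Re (of_real S) - Re (of_real S))) {0..1}"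
    using has_integral_linear[OF intf bounded_linear_Re] has_integral_linear[OF intP bounded_linear_Re]
    by (intro has_integral_diff has_integral_mult_right) (auto simp: o_def)
  have "continuous_on {0..1} (\<lambda>t. f (\<gamma> t))"
  proof (rule continuous_on_compose2[of "ball 0 1" f])
    show "continuous_on {0..1} \<gamma>"
      unfolding \<gamma>_def circlepath by (intro continuous_intros)
    show "\<gamma> ` {0..1} \<subseteq> ball 0 1" using norm_\<gamma> r by auto
  qed (use f holomorphic_on_imp_continuous_on in blast)
  then show *: "(\<lambda>t. (cmod (f (circlepath 0 r t)))\<^sup>2) integrable_on {0..1}"
    unfolding \<gamma>_def by (intro integrable_continuous_real continuous_intros)
  have "2 * Re (of_real S) - Re (of_real S) \<le> integral {0..1} (\<lambda>t. (cmod (f (\<gamma> t)))\<^sup>2)"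
  proof (rule has_integral_le[OF low])
    show "((\<lambda>t. (cmod (f (\<gamma> t)))\<^sup>2) has_integral integral {0..1} (\<lambda>t. (cmod (f (\<gamma> t)))\<^sup>2)) {0..1}"
      using * by (simp add: \<gamma>_def has_integral_integral)
    fix t
    have "0 \<le> (cmod (f (\<gamma> t) - P (\<gamma> t)))\<^sup>2" by simp
    then show "2 * Re (f (\<gamma> t) * cnj (P (\<gamma> t))) - Re (P (\<gamma> t) * cnj (P (\<gamma> t))) \<le> (cmod (f (\<gamma> t)))\<^sup>2"
      unfolding cmod_power2 by (simp add: power2_eq_square algebra_simps)
  qed
  then show "(\<Sum>n<L. (cmod (taylor_coeff f n))\<^sup>2 * r ^ (2 * n))
      \<le> integral {0..1} (\<lambda>t. (cmod (f (circlepath 0 r t)))\<^sup>2)"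
    by (simp add: S_def a_def \<gamma>_def)
qed

text \<open>The sum over the family is taken under the integral, so that the bound \<open>C\<close>
  on the sum of squares is used once for the whole family. The parameter interval has length 1,
  hence the mean is at most \<open>C\<close>.\<close>

lemma Bessel_bounded_family:
  assumes "finite I" and hol: "\<And>i. i \<in> I \<Longrightarrow> f i holomorphic_on ball 0 1"
    and bound: "\<And>z. z \<in> ball 0 1 \<Longrightarrow> (\<Sum>i\<in>I. (cmod (f i z))\<^sup>2) \<le> C"
  shows "(\<Sum>i\<in>I. \<Sum>n<L. (cmod (taylor_coeff (f i) n))\<^sup>2) \<le> C"
proof -
  define S where "S r = (\<Sum>i\<in>I. \<Sum>n<L. (cmod (taylor_coeff (f i) n))\<^sup>2 * r ^ (2 * n))" for r :: real
  have S_le: "S r \<le> C" if r: "0 < r" "r < 1" for r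
  proof -
    have "S r \<le> (\<Sum>i\<in>I. integral {0..1} (\<lambda>t. (cmod (f i (circlepath 0 r t)))\<^sup>2))"
      unfolding S_def using hol r by (intro sum_mono Bessel_circle)
    also have "\<dots> = integral {0..1} (\<lambda>t. \<Sum>i\<in>I. (cmod (f i (circlepath 0 r t)))\<^sup>2)"
      using hol r \<open>finite I\<close> by (intro integral_sum[symmetric] Bessel_circle) auto
    also have "\<dots> \<le> integral {0..1} (\<lambda>t::real. C)"
    proof (rule integral_le)
      show "(\<lambda>t. \<Sum>i\<in>I. (cmod (f i (circlepath 0 r t)))\<^sup>2) integrable_on {0..1}"
        using hol r \<open>finite I\<close> by (intro integrable_sum Bessel_circle) auto
      show "(\<Sum>i\<in>I. (cmod (f i (circlepath 0 r t)))\<^sup>2) \<le> C" for t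
        using r by (intro bound) (simp add: circlepath norm_mult)
    qed auto
    finally show ?thesis by simp
  qed
  \<comment> \<open>\<open>S\<close> is a polynomial in the radius, so the estimate passes to the
    limit at radius 1.\<close>
  have "(S \<longlongrightarrow> S 1) (at_left 1)"
    unfolding S_def by (intro tendsto_intros)
  moreover have "eventually (\<lambda>r. S r \<le> C) (at_left 1)"
    using eventually_at_left_real[of 0 "1::real"] by (auto elim!: eventually_mono intro: S_le)
  ultimately have "S 1 \<le> C"
    by (intro tendsto_upperbound) auto
  then show ?thesis by (simp add: S_def)
qed

text \<open>Let \<open>L\<close> tend to infinity in the preceding bound. A one-element index set
  gives the statement for a single function; the images of monomials give Hilbert--Schmidt
  sums.\<close>

lemma H2_bounded_family:
  assumes "finite I" and hol: "\<And>i. i \<in> I \<Longrightarrow> f i holomorphic_on ball 0 1"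
    and bound: "\<And>z. z \<in> ball 0 1 \<Longrightarrow> (\<Sum>i\<in>I. (cmod (f i z))\<^sup>2) \<le> C"
  shows "\<And>i. i \<in> I \<Longrightarrow> f i \<in> H2" and "(\<Sum>i\<in>I. (h2_norm (f i))\<^sup>2) \<le> C"
proof -
  have Bessel: "(\<Sum>i\<in>I. \<Sum>n<L. (cmod (taylor_coeff (f i) n))\<^sup>2) \<le> C" for L
    using assms by (rule Bessel_bounded_family)
  show H: "f i \<in> H2" if "i \<in> I" for i
  proof (rule H2_I_bounded(1)[OF hol[OF that]])
    show "(\<Sum>n<L. (cmod (taylor_coeff (f i) n))\<^sup>2) \<le> C" for L
      using member_le_sum[OF that, of "\<lambda>i. \<Sum>n<L. (cmod (taylor_coeff (f i) n))\<^sup>2"] Bessel[of L] \<open>finite I\<close>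
      by (auto simp: sum_nonneg)
  qed
  have "(\<lambda>L. \<Sum>i\<in>I. \<Sum>n<L. (cmod (taylor_coeff (f i) n))\<^sup>2) \<longlonglongrightarrow> (\<Sum>i\<in>I. (h2_norm (f i))\<^sup>2)"
    by (intro tendsto_sum) (use summable_LIMSEQ H2_summable H h2_norm_square in force)
  then show "(\<Sum>i\<in>I. (h2_norm (f i))\<^sup>2) \<le> C"
    by (rule LIMSEQ_le_const2) (use Bessel in auto)
qed

section \<open>Holomorphic majorants\<close>

text \<open>With \<open>h j = (\<Sum>n. z ^ n * b (n + j))\<close>, so that \<open>b j = h j - z * h (j + 1)\<close>, the real part of
  \<open>(2 * h j - b j) * cnj (b j)\<close> is \<open>\<bar>h j\<bar>\<^sup>2 - \<bar>z\<bar>\<^sup>2 * \<bar>h (j + 1)\<bar>\<^sup>2\<close>, and the sum over \<open>j\<close> telescopes.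
  The polynomial is a Herglotz transform of the square of the modulus of \<open>\<Sum>n<L. a n * z ^ n\<close>.\<close>

definition herglotz_poly :: "(nat \<Rightarrow> complex) \<Rightarrow> nat \<Rightarrow> complex \<Rightarrow> complex" where
  "herglotz_poly a L z =
     (let b = (\<lambda>j. if j < L then a j else 0)
      in \<Sum>j<L. (2 * (\<Sum>n<L. z ^ n * b (n + j)) - b j) * cnj (b j))"

lemma holomorphic_herglotz_poly: "herglotz_poly a L holomorphic_on S"
  unfolding herglotz_poly_def Let_def by (intro holomorphic_intros)

lemma Re_herglotz_poly_ge:
  assumes "cmod z < 1"
  shows "(cmod (\<Sum>n<L. a n * z ^ n))\<^sup>2 \<le> Re (herglotz_poly a L z)"
proof -
  define b where "b j = (if j < L then a j else 0)" for j
  define h where "h j = (\<Sum>n<L. z ^ n * b (n + j))" for j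
  have rec: "h j = b j + z * h (Suc j)" for j
  proof -
    have "z * h (Suc j) = (\<Sum>n<L. z ^ Suc n * b (Suc n + j))"
      by (simp add: h_def sum_distrib_left mult.assoc)
    then have "b j + z * h (Suc j) = (\<Sum>n<Suc L. z ^ n * b (n + j))"
      by (simp only: sum.lessThan_Suc_shift) simp
    \<comment> \<open>The extra term \<open>n = L\<close> vanishes, because \<open>b\<close> is zero
      from index \<open>L\<close> on.\<close>
    also have "\<dots> = h j" by (simp add: h_def b_def)
    finally show ?thesis ..
  qed
  have step: "(cmod (h j))\<^sup>2 - (cmod (h (Suc j)))\<^sup>2 \<le> Re ((2 * h j - b j) * cnj (b j))" for j
  proof -
    have b: "b j = h j - z * h (Suc j)" using rec[of j] by simp
    have "Re ((2 * h j - b j) * cnj (b j)) = (cmod (h j))\<^sup>2 - (cmod (z * h (Suc j)))\<^sup>2"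
      unfolding b cmod_power2 by (simp add: power2_eq_square algebra_simps)
    moreover have "(cmod (z * h (Suc j)))\<^sup>2 \<le> (cmod (h (Suc j)))\<^sup>2"
      using assms by (intro power_mono) (auto simp: norm_mult mult_left_le_one_le)
    ultimately show ?thesis by simp
  qed
  have "(\<Sum>n<L. a n * z ^ n) = h 0"
    by (simp add: h_def b_def mult.commute)
  moreover have "h L = 0" by (simp add: h_def b_def)
  ultimately have "(cmod (\<Sum>n<L. a n * z ^ n))\<^sup>2 = (\<Sum>j<L. (cmod (h j))\<^sup>2 - (cmod (h (Suc j)))\<^sup>2)"
    using sum_lessThan_telescope'[of "\<lambda>j. (cmod (h j))\<^sup>2" L] by simp
  also have "\<dots> \<le> (\<Sum>j<L. Re ((2 * h j - b j) * cnj (b j)))"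
    by (intro sum_mono step)
  also have "\<dots> = Re (herglotz_poly a L z)"
    unfolding herglotz_poly_def Let_def b_def h_def by (simp only: Re_sum)
  finally show ?thesis .
qed

text \<open>Collected by powers of \<open>z\<close>, the double sum has as coefficients the
  autocorrelations of \<open>b\<close>, each bounded by the squared norm; a geometric series does
  the rest. For \<open>H2\<close> coefficients the bound is uniform in \<open>L\<close>, as a normal
  family argument requires.\<close>

lemma cmod_herglotz_poly_le:
  assumes "cmod z < 1"
  shows "cmod (herglotz_poly a L z) \<le> (1 + 2 / (1 - cmod z)) * (\<Sum>n<L. (cmod (a n))\<^sup>2)"
proof -
  define b where "b j = (if j < L then a j else 0)" for j
  define A where "A = (\<Sum>n<L. (cmod (a n))\<^sup>2)"
  have A0: "0 \<le> A" by (simp add: A_def sum_nonneg)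
  have sb: "(\<Sum>j<L. (cmod (b j))\<^sup>2) = A" by (simp add: A_def b_def)
  have corr: "cmod (\<Sum>j<L. b (n + j) * cnj (b j)) \<le> A" for n
  proof -
    have "cmod (\<Sum>j<L. b (n + j) * cnj (b j)) \<le> (\<Sum>j<L. ((cmod (b (n + j)))\<^sup>2 + (cmod (b j))\<^sup>2) / 2)"
    proof (rule sum_norm_le)
      fix j
      show "cmod (b (n + j) * cnj (b j)) \<le> ((cmod (b (n + j)))\<^sup>2 + (cmod (b j))\<^sup>2) / 2"
        using zero_le_power2[of "cmod (b (n + j)) - cmod (b j)"]
        by (simp add: norm_mult power2_eq_square algebra_simps)
    qed
    also have "\<dots> = ((\<Sum>j<L. (cmod (b (n + j)))\<^sup>2) + A) / 2"
      by (simp add: sb[symmetric] sum.distrib sum_divide_distrib[symmetric])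
    also have "(\<Sum>j<L. (cmod (b (n + j)))\<^sup>2) \<le> A"
    proof -
      \<comment> \<open>A shift only loses terms: the indices pushed to \<open>L\<close> or beyond
        carry the value zero.\<close>
      have "(\<Sum>j<L. (cmod (b (n + j)))\<^sup>2) = (\<Sum>k\<in>(+) n ` {..<L}. (cmod (b k))\<^sup>2)"
        by (subst sum.reindex) auto
      also have "\<dots> = (\<Sum>k\<in>((+) n ` {..<L}) \<inter> {..<L}. (cmod (b k))\<^sup>2)"
        by (rule sum.mono_neutral_right) (auto simp: b_def)
      also have "\<dots> \<le> (\<Sum>k<L. (cmod (b k))\<^sup>2)"
        by (rule sum_mono2) auto
      finally show ?thesis by (simp add: sb)
    qed
    finally show ?thesis by simp
  qed
  have "(\<Sum>j<L. (\<Sum>n<L. z ^ n * b (n + j)) * cnj (b j)) = (\<Sum>n<L. z ^ n * (\<Sum>j<L. b (n + j) * cnj (b j)))"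
    unfolding sum_distrib_right sum_distrib_left by (subst sum.swap) (simp add: mult_ac)
  also have "cmod \<dots> \<le> (\<Sum>n<L. cmod z ^ n * A)"
    using corr by (intro sum_norm_le) (auto simp: norm_mult norm_power intro: mult_left_mono)
  also have "\<dots> = (\<Sum>n<L. cmod z ^ n) * A" by (simp add: sum_distrib_right)
  also have "\<dots> \<le> (1 / (1 - cmod z)) * A"
  proof (rule mult_right_mono[OF _ A0])
    have "(\<Sum>n<L. cmod z ^ n) \<le> (\<Sum>n. cmod z ^ n)"
      using assms by (intro sum_le_suminf summable_geometric) auto
    then show "(\<Sum>n<L. cmod z ^ n) \<le> 1 / (1 - cmod z)"
      using assms by (simp add: suminf_geometric)
  qed
  finally have main: "cmod (\<Sum>j<L. (\<Sum>n<L. z ^ n * b (n + j)) * cnj (b j)) \<le> 1 / (1 - cmod z) * A" .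
  have diag: "cmod (\<Sum>j<L. b j * cnj (b j)) \<le> A" using corr[of 0] by simp
  have "herglotz_poly a L z = 2 * (\<Sum>j<L. (\<Sum>n<L. z ^ n * b (n + j)) * cnj (b j)) - (\<Sum>j<L. b j * cnj (b j))"
    unfolding herglotz_poly_def Let_def b_def[symmetric]
    by (simp add: left_diff_distrib sum_subtractf mult.assoc sum_distrib_left[symmetric])
  also have "cmod \<dots> \<le> 2 * cmod (\<Sum>j<L. (\<Sum>n<L. z ^ n * b (n + j)) * cnj (b j)) + cmod (\<Sum>j<L. b j * cnj (b j))"
    by (rule order_trans[OF norm_triangle_ineq4]) (simp add: norm_mult)
  also have "\<dots> \<le> 2 * (1 / (1 - cmod z) * A) + A" using main diag by linarith
  finally show ?thesis by (simp add: A_def algebra_simps)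
qed

text \<open>Weighted sums of Herglotz polynomials are locally bounded by the convergent series of
  norms, so Montel's theorem yields a limit \<open>G\<close>. The real parts of all summands are
  nonnegative, hence each single summand stays below the real part of \<open>G\<close>.\<close>

lemma holomorphic_majorant:
  assumes "\<And>i. finite (I i)" and g: "\<And>i n. n \<in> I i \<Longrightarrow> g n \<in> H2"
    and c: "\<And>i. (0::real) \<le> c i" and sm: "summable (\<lambda>i. c i * (\<Sum>n\<in>I i. (h2_norm (g n))\<^sup>2))"
  obtains G where "G holomorphic_on ball 0 1"
    and "\<And>i z. z \<in> ball 0 1 \<Longrightarrow> c i * (\<Sum>n\<in>I i. (cmod (g n z))\<^sup>2) \<le> Re (G z)"
proof -
  define \<Lambda> where "\<Lambda> = (\<Sum>i. c i * (\<Sum>n\<in>I i. (h2_norm (g n))\<^sup>2))"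
  \<comment> \<open>\<open>J\<close> is both the number of summands and the truncation degree, so
    that one sequence handles both limits.\<close>
  define F where "F J z = (\<Sum>i<J. of_real (c i) * (\<Sum>n\<in>I i. herglotz_poly (taylor_coeff (g n)) J z))"
    for J :: nat and z
  have hol: "F J holomorphic_on ball 0 1" for J
    unfolding F_def by (intro holomorphic_intros holomorphic_herglotz_poly)
  have F_le: "cmod (F J z) \<le> (1 + 2 / (1 - cmod z)) * \<Lambda>" if z: "cmod z < 1" for J z
  proof -
    have "cmod (F J z) \<le> (\<Sum>i<J. c i * (\<Sum>n\<in>I i. (1 + 2 / (1 - cmod z)) * (h2_norm (g n))\<^sup>2))"
      unfolding F_def
    proof (rule sum_norm_le)
      fix i
      have "cmod (\<Sum>n\<in>I i. herglotz_poly (taylor_coeff (g n)) J z)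
          \<le> (\<Sum>n\<in>I i. (1 + 2 / (1 - cmod z)) * (h2_norm (g n))\<^sup>2)"
      proof (rule sum_norm_le)
        fix n assume n: "n \<in> I i"
        have "cmod (herglotz_poly (taylor_coeff (g n)) J z)
            \<le> (1 + 2 / (1 - cmod z)) * (\<Sum>k<J. (cmod (taylor_coeff (g n) k))\<^sup>2)"
          by (rule cmod_herglotz_poly_le[OF z])
        also have "\<dots> \<le> (1 + 2 / (1 - cmod z)) * (h2_norm (g n))\<^sup>2"
          using z by (intro mult_left_mono sum_taylor_coeff_le g[OF n]) auto
        finally show "cmod (herglotz_poly (taylor_coeff (g n)) J z) \<le> (1 + 2 / (1 - cmod z)) * (h2_norm (g n))\<^sup>2" .
      qed
      then show "cmod (of_real (c i) * (\<Sum>n\<in>I i. herglotz_poly (taylor_coeff (g n)) J z))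
          \<le> c i * (\<Sum>n\<in>I i. (1 + 2 / (1 - cmod z)) * (h2_norm (g n))\<^sup>2)"
        using c[of i] by (simp add: norm_mult mult_left_mono)
    qed
    also have "\<dots> = (1 + 2 / (1 - cmod z)) * (\<Sum>i<J. c i * (\<Sum>n\<in>I i. (h2_norm (g n))\<^sup>2))"
      by (simp add: sum_distrib_left mult_ac)
    also have "\<dots> \<le> (1 + 2 / (1 - cmod z)) * \<Lambda>"
      unfolding \<Lambda>_def using z c by (intro mult_left_mono sum_le_suminf sm) (auto simp: sum_nonneg)
    finally show ?thesis .
  qed
  have Re_F: "c i * (\<Sum>n\<in>I i. (cmod (\<Sum>k<J. taylor_coeff (g n) k * z ^ k))\<^sup>2) \<le> Re (F J z)"
    if z: "cmod z < 1" and J: "i < J" for i J z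
  proof -
    have "c i * (\<Sum>n\<in>I i. (cmod (\<Sum>k<J. taylor_coeff (g n) k * z ^ k))\<^sup>2)
        \<le> (\<Sum>i<J. c i * (\<Sum>n\<in>I i. (cmod (\<Sum>k<J. taylor_coeff (g n) k * z ^ k))\<^sup>2))"
      using J c by (intro member_le_sum) (auto simp: sum_nonneg)
    also have "\<dots> \<le> (\<Sum>i<J. c i * (\<Sum>n\<in>I i. Re (herglotz_poly (taylor_coeff (g n)) J z)))"
      by (intro sum_mono mult_left_mono Re_herglotz_poly_ge z c)
    also have "\<dots> = Re (F J z)" by (simp add: F_def)
    finally show ?thesis .
  qed
  obtain G r where G: "G holomorphic_on ball 0 1" "strict_mono (r :: nat \<Rightarrow> nat)"
    and lim: "\<And>z. z \<in> ball 0 1 \<Longrightarrow> (\<lambda>k. F (r k) z) \<longlonglongrightarrow> G z"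
  proof (rule Montel[of "ball 0 1" "range F" F])
    show "\<exists>B. \<forall>h\<in>range F. \<forall>z\<in>K. cmod (h z) \<le> B" if K: "compact K" "K \<subseteq> ball 0 1" for K
    proof -
      have "continuous_on K (\<lambda>z. (1 + 2 / (1 - cmod z)) * \<Lambda>)"
        using K by (intro continuous_intros) auto
      then have "bounded ((\<lambda>z. (1 + 2 / (1 - cmod z)) * \<Lambda>) ` K)"
        using K compact_continuous_image compact_imp_bounded by blast
      then obtain B where "\<And>z. z \<in> K \<Longrightarrow> (1 + 2 / (1 - cmod z)) * \<Lambda> \<le> B"
        unfolding bounded_real by (metis abs_le_D1 image_eqI)
      moreover have "cmod z < 1" if "z \<in> K" for z using K that by auto
      ultimately show ?thesis using F_le by (metis (no_types, lifting) imageE order_trans)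
    qed
  qed (use hol in auto)
  have "c i * (\<Sum>n\<in>I i. (cmod (g n z))\<^sup>2) \<le> Re (G z)" if z: "z \<in> ball 0 1" for i z
  proof (rule LIMSEQ_le)
    show "(\<lambda>k. Re (F (r k) z)) \<longlonglongrightarrow> Re (G z)"
      by (intro tendsto_intros lim z)
    have "(\<lambda>J. \<Sum>k<J. taylor_coeff (g n) k * z ^ k) \<longlonglongrightarrow> g n z" if "n \<in> I i" for n
      using taylor_sums[OF H2_holomorphic[OF g[OF that]] z] by (simp add: sums_def)
    then have "(\<lambda>J. c i * (\<Sum>n\<in>I i. (cmod (\<Sum>k<J. taylor_coeff (g n) k * z ^ k))\<^sup>2))
        \<longlonglongrightarrow> c i * (\<Sum>n\<in>I i. (cmod (g n z))\<^sup>2)"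
      by (intro tendsto_intros)
    from LIMSEQ_subseq_LIMSEQ[OF this G(2)]
    show "(\<lambda>k. c i * (\<Sum>n\<in>I i. (cmod (\<Sum>l<r k. taylor_coeff (g n) l * z ^ l))\<^sup>2))
        \<longlonglongrightarrow> c i * (\<Sum>n\<in>I i. (cmod (g n z))\<^sup>2)"
      by (simp add: o_def)
    \<comment> \<open>A strictly increasing \<open>r\<close> satisfies \<open>k \<le> r k\<close>,
      so the summand \<open>i\<close> is present from \<open>k = Suc i\<close> on.\<close>
    have "i < r k" if "k \<ge> Suc i" for k
      using seq_suble[OF G(2), of k] that by simp
    then show "\<exists>N. \<forall>k\<ge>N. c i * (\<Sum>n\<in>I i. (cmod (\<Sum>l<r k. taylor_coeff (g n) l * z ^ l))\<^sup>2) \<le> Re (F (r k) z)"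
      using Re_F z by (intro exI[of _ "Suc i"]) auto
  qed
  with G(1) that show ?thesis by blast
qed

section \<open>Finite rank approximation\<close>

text \<open>Pythagoras for the orthogonal projection off \<open>v\<close> in the space of the first
  \<open>L\<close> coordinates.\<close>

lemma projection_norm:
  fixes y v :: "nat \<Rightarrow> complex" and L :: nat
  defines "s \<equiv> (\<Sum>k<L. (cmod (v k))\<^sup>2)" and "p \<equiv> (\<Sum>k<L. y k * cnj (v k))"
  assumes "s \<noteq> 0"
  shows "(\<Sum>k<L. (cmod (y k - p / of_real s * v k))\<^sup>2) = (\<Sum>k<L. (cmod (y k))\<^sup>2) - (cmod p)\<^sup>2 / s"
proof -
  define q where "q = p / of_real s"
  have "(\<Sum>k<L. (cmod (y k - q * v k))\<^sup>2) =
      (\<Sum>k<L. (cmod (y k))\<^sup>2 - 2 * Re (cnj q * (y k * cnj (v k))) + (cmod q)\<^sup>2 * (cmod (v k))\<^sup>2)"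
    by (rule sum.cong) (simp_all only: cmod_power2, simp_all add: power2_eq_square algebra_simps)
  also have "\<dots> = (\<Sum>k<L. (cmod (y k))\<^sup>2) - 2 * Re (cnj q * p) + (cmod q)\<^sup>2 * s"
    unfolding s_def p_def by (simp only: sum.distrib sum_subtractf sum_distrib_left Re_sum)
  also have "Re (cnj q * p) = (cmod p)\<^sup>2 / s"
  proof -
    have "cnj q * p = of_real ((cmod p)\<^sup>2 / s)"
      using complex_norm_square[of p] by (simp add: q_def mult.commute)
    then show ?thesis by (metis Re_complex_of_real)
  qed
  also have "(cmod q)\<^sup>2 * s = (cmod p)\<^sup>2 / s"
    using assms(3) by (simp add: q_def norm_divide power_divide power2_eq_square)
  finally show ?thesis by (simp add: q_def)
qed

text \<open>Projecting off the last spanning vector lowers the dimension by one and, by duality,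
  removes at most \<open>K\<close> from the squared Hilbert--Schmidt norm.\<close>

lemma finite_rank_hilbert_schmidt_bound:
  fixes x Y :: "nat \<Rightarrow> nat \<Rightarrow> complex"
  assumes "0 \<le> K"
    and "\<And>n k. n < M \<Longrightarrow> k < L \<Longrightarrow> x n k = (\<Sum>i<N. c n i * Y i k)"
    and "\<And>t. (\<Sum>k<L. (cmod (\<Sum>n<M. t n * x n k))\<^sup>2) \<le> K * (\<Sum>n<M. (cmod (t n))\<^sup>2)"
  shows "(\<Sum>n<M. \<Sum>k<L. (cmod (x n k))\<^sup>2) \<le> real N * K"
  using assms(2,3)
proof (induction N arbitrary: x Y)
  case 0
  then show ?case by simp
next
  case (Suc N)
  define v where "v = Y N"
  define s where "s = (\<Sum>k<L. (cmod (v k))\<^sup>2)"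
  show ?case
  proof (cases "s = 0")
    case True
    then have "v k = 0" if "k < L" for k
      using that by (simp add: s_def sum_nonneg_eq_0_iff)
    then have "x n k = (\<Sum>i<N. c n i * Y i k)" if "n < M" "k < L" for n k
      using Suc.prems(1)[OF that] that by (simp add: v_def)
    then have "(\<Sum>n<M. \<Sum>k<L. (cmod (x n k))\<^sup>2) \<le> real N * K"
      using Suc.prems(2) by (rule Suc.IH)
    also have "\<dots> \<le> real (Suc N) * K" using \<open>0 \<le> K\<close> by (intro mult_right_mono) auto
    finally show ?thesis .
  next
    case False
    then have "s > 0" unfolding s_def by (metis less_eq_real_def sum_nonneg zero_le_power2)
    define ip where "ip y = (\<Sum>k<L. y k * cnj (v k))" for y
    define x' where "x' n k = x n k - ip (x n) / of_real s * v k" for n k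
    define Y' where "Y' i k = Y i k - ip (Y i) / of_real s * v k" for i k
    have ip_sum: "ip (\<lambda>k. \<Sum>i\<in>I. d i * y i k) = (\<Sum>i\<in>I. d i * ip (y i))" for I and d :: "nat \<Rightarrow> complex" and y
      unfolding ip_def sum_distrib_right sum_distrib_left by (subst sum.swap) (simp add: mult.assoc)
    have proj: "(\<Sum>k<L. (cmod (y k - ip y / of_real s * v k))\<^sup>2) = (\<Sum>k<L. (cmod (y k))\<^sup>2) - (cmod (ip y))\<^sup>2 / s"
      for y
      using projection_norm[of v L y] False by (simp add: s_def ip_def)
    \<comment> \<open>The last spanning vector is projected to zero, so the remaining
      \<open>N\<close> projected vectors suffice.\<close>
    have x'_span: "x' n k = (\<Sum>i<N. c n i * Y' i k)" if "n < M" "k < L" for n k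
    proof -
      have "ip (x n) = ip (\<lambda>k. \<Sum>i<Suc N. c n i * Y i k)"
        unfolding ip_def by (intro sum.cong) (use Suc.prems(1)[OF \<open>n < M\<close>] in auto)
      then have "x' n k = (\<Sum>i<Suc N. c n i * Y i k) - (\<Sum>i<Suc N. c n i * ip (Y i)) / of_real s * v k"
        unfolding x'_def Suc.prems(1)[OF that] ip_sum by simp
      also have "\<dots> = (\<Sum>i<Suc N. c n i * Y' i k)"
        by (simp only: Y'_def right_diff_distrib sum_subtractf sum_divide_distrib sum_distrib_right) (simp add: mult.assoc)
      also have "Y' N k = 0"
      proof -
        have "ip (Y N) = of_real s"
          unfolding ip_def s_def v_def of_real_sum complex_norm_square by simp
        then show ?thesis using False by (simp add: Y'_def v_def)
      qed
      then have "(\<Sum>i<Suc N. c n i * Y' i k) = (\<Sum>i<N. c n i * Y' i k)" by simp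
      finally show ?thesis .
    qed
    have x'_bound: "(\<Sum>k<L. (cmod (\<Sum>n<M. t n * x' n k))\<^sup>2) \<le> K * (\<Sum>n<M. (cmod (t n))\<^sup>2)" for t
    proof -
      define y where "y k = (\<Sum>n<M. t n * x n k)" for k
      have "(\<Sum>n<M. t n * x' n k) = y k - ip y / of_real s * v k" for k
        unfolding y_def ip_sum x'_def right_diff_distrib sum_subtractf sum_divide_distrib sum_distrib_right
        by (simp add: mult.assoc)
      then have "(\<Sum>k<L. (cmod (\<Sum>n<M. t n * x' n k))\<^sup>2) \<le> (\<Sum>k<L. (cmod (y k))\<^sup>2)"
        using proj[of y] \<open>s > 0\<close> by simp
      also have "\<dots> \<le> K * (\<Sum>n<M. (cmod (t n))\<^sup>2)"
        unfolding y_def by (rule Suc.prems(2))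
      finally show ?thesis .
    qed
    have IH: "(\<Sum>n<M. \<Sum>k<L. (cmod (x' n k))\<^sup>2) \<le> real N * K"
      using x'_span x'_bound by (rule Suc.IH)
    define Q where "Q = (\<Sum>n<M. (cmod (ip (x n)))\<^sup>2)"
    have "Q \<le> K * s"
    proof (cases "Q = 0")
      case True
      then show ?thesis using \<open>0 \<le> K\<close> \<open>s > 0\<close> by simp
    next
      case False
      then have "Q > 0" unfolding Q_def by (metis less_eq_real_def sum_nonneg zero_le_power2)
      \<comment> \<open>Duality: testing with the coefficients \<open>cnj (ip (x n))\<close> gives
        \<open>ip y = of_real Q\<close>. The nonnegative residual of \<open>y\<close> is
        Cauchy-Schwarz, and together with the operator bound it gives
        \<open>Q^2 / s \<le> K * Q\<close>.\<close>
      define y where "y k = (\<Sum>n<M. cnj (ip (x n)) * x n k)" for k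
      have "ip y = of_real Q"
        unfolding y_def ip_sum Q_def of_real_sum complex_norm_square by (simp add: mult.commute)
      moreover have "0 \<le> (\<Sum>k<L. (cmod (y k))\<^sup>2) - (cmod (ip y))\<^sup>2 / s"
        unfolding proj[symmetric] by (simp add: sum_nonneg)
      moreover have "(\<Sum>k<L. (cmod (y k))\<^sup>2) \<le> K * Q"
        using Suc.prems(2)[of "\<lambda>n. cnj (ip (x n))"] by (simp add: y_def Q_def)
      ultimately have "Q\<^sup>2 / s \<le> K * Q" by simp
      then have "Q * Q \<le> (K * s) * Q"
        using \<open>s > 0\<close> by (simp add: field_simps power2_eq_square)
      then show ?thesis using \<open>Q > 0\<close> by simp
    qed
    have "(\<Sum>n<M. \<Sum>k<L. (cmod (x n k))\<^sup>2) = (\<Sum>n<M. (\<Sum>k<L. (cmod (x' n k))\<^sup>2) + (cmod (ip (x n)))\<^sup>2 / s)"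
      unfolding x'_def proj by simp
    also have "\<dots> = (\<Sum>n<M. \<Sum>k<L. (cmod (x' n k))\<^sup>2) + Q / s"
      by (simp add: Q_def sum.distrib sum_divide_distrib)
    also have "\<dots> \<le> real N * K + K"
      using IH \<open>Q \<le> K * s\<close> \<open>s > 0\<close> by (intro add_mono) (auto simp: field_simps)
    finally show ?thesis by (simp add: algebra_simps)
  qed
qed

text \<open>The spanning functions in \<open>h2_rank_le\<close> are arbitrary and may fail to be
  holomorphic; members of the range do have Taylor coefficients. In the induction, the elements
  spanned by the first \<open>N\<close> functions form a subspace \<open>V'\<close> of codimension
  at most one in \<open>V\<close>.\<close>

lemma subspace_spanned_by_members:
  fixes V :: "('a \<Rightarrow> complex) set" and N :: nat
  assumes "V \<noteq> {}"
    and "\<And>f g a. f \<in> V \<Longrightarrow> g \<in> V \<Longrightarrow> (\<lambda>x. a * f x + g x) \<in> V"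
    and "\<And>f. f \<in> V \<Longrightarrow> \<exists>c. \<forall>x\<in>D. f x = (\<Sum>i<N. c i * b i x)"
  shows "\<exists>y. (\<forall>i<N. y i \<in> V) \<and> (\<forall>f\<in>V. \<exists>c. \<forall>x\<in>D. f x = (\<Sum>i<N. c i * y i x))"
  using assms
proof (induction N arbitrary: V)
  case 0
  then show ?case by auto
next
  case (Suc N)
  define V' where "V' = {f \<in> V. \<exists>c. \<forall>x\<in>D. f x = (\<Sum>i<N. c i * b i x)}"
  have lin: "(\<lambda>x. a * f x + g x) \<in> V'" if fg: "f \<in> V'" "g \<in> V'" for f g a
  proof -
    obtain c d where c: "\<And>x. x \<in> D \<Longrightarrow> f x = (\<Sum>i<N. c i * b i x)"
      and d: "\<And>x. x \<in> D \<Longrightarrow> g x = (\<Sum>i<N. d i * b i x)"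
      using fg unfolding V'_def by blast
    have "\<forall>x\<in>D. a * f x + g x = (\<Sum>i<N. (a * c i + d i) * b i x)"
      by (simp add: c d sum_distrib_left sum.distrib distrib_right mult.assoc)
    moreover have "(\<lambda>x. a * f x + g x) \<in> V"
      using fg Suc.prems(2) by (auto simp: V'_def)
    ultimately show ?thesis
      unfolding V'_def by (auto intro!: exI[of _ "\<lambda>i. a * c i + d i"])
  qed
  have zero: "(\<lambda>x. 0) \<in> V"
  proof -
    obtain f where "f \<in> V" using Suc.prems(1) by blast
    from Suc.prems(2)[OF this this, of "-1"] show ?thesis by simp
  qed
  then have "(\<lambda>x. 0) \<in> V'"
    unfolding V'_def by (auto intro: exI[of _ "\<lambda>_. 0"])
  then have "V' \<noteq> {}" by blast
  from Suc.IH[OF this lin] obtain y where y: "\<And>i. i < N \<Longrightarrow> y i \<in> V'"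
    and sp: "\<And>f. f \<in> V' \<Longrightarrow> \<exists>c. \<forall>x\<in>D. f x = (\<Sum>i<N. c i * y i x)"
    unfolding V'_def by blast
  \<comment> \<open>\<open>u\<close> spans a complement of \<open>V'\<close>; if \<open>V'\<close>
    is all of \<open>V\<close>, the zero function serves.\<close>
  have "\<exists>u\<in>V. \<forall>f\<in>V. \<exists>t. (\<lambda>x. f x - t * u x) \<in> V'"
  proof (cases "V \<subseteq> V'")
    case True
    then show ?thesis using zero by (intro bexI[of _ "\<lambda>x. 0"]) auto
  next
    case False
    then obtain u where u: "u \<in> V" "u \<notin> V'" by blast
    obtain c where c: "\<And>x. x \<in> D \<Longrightarrow> u x = (\<Sum>i<Suc N. c i * b i x)"
      using Suc.prems(3)[OF u(1)] by blast
    have "c N \<noteq> 0" using c u unfolding V'_def by force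
    have "\<exists>t. (\<lambda>x. f x - t * u x) \<in> V'" if f: "f \<in> V" for f
    proof -
      obtain d where d: "\<And>x. x \<in> D \<Longrightarrow> f x = (\<Sum>i<Suc N. d i * b i x)"
        using Suc.prems(3)[OF f] by blast
      \<comment> \<open>This choice cancels the coefficient of \<open>b N\<close>.\<close>
      define t where "t = d N / c N"
      have "\<forall>x\<in>D. f x - t * u x = (\<Sum>i<N. (d i - t * c i) * b i x)"
      proof
        fix x assume "x \<in> D"
        then have "f x - t * u x = (\<Sum>i<Suc N. (d i - t * c i) * b i x)"
          unfolding c[OF \<open>x \<in> D\<close>] d[OF \<open>x \<in> D\<close>]
          by (simp only: sum_distrib_left left_diff_distrib sum_subtractf mult.assoc)
        then show "f x - t * u x = (\<Sum>i<N. (d i - t * c i) * b i x)"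
          using \<open>c N \<noteq> 0\<close> by (simp add: t_def)
      qed
      moreover have "(\<lambda>x. f x - t * u x) \<in> V"
        using Suc.prems(2)[OF u(1) f, of "- t"] by simp
      ultimately have "(\<lambda>x. f x - t * u x) \<in> V'"
        unfolding V'_def by (auto intro!: exI[of _ "\<lambda>i. d i - t * c i"])
      then show ?thesis by blast
    qed
    with u(1) show ?thesis by blast
  qed
  then obtain u where u: "u \<in> V" "\<And>f. f \<in> V \<Longrightarrow> \<exists>t. (\<lambda>x. f x - t * u x) \<in> V'" by blast
  define z where "z = y(N := u)"
  have "\<exists>c. \<forall>x\<in>D. f x = (\<Sum>i<Suc N. c i * z i x)" if f: "f \<in> V" for f
  proof -
    obtain t c where t: "\<And>x. x \<in> D \<Longrightarrow> f x - t * u x = (\<Sum>i<N. c i * y i x)"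
      using u(2)[OF f] sp by blast
    have "\<forall>x\<in>D. f x = (\<Sum>i<Suc N. (c(N := t)) i * z i x)"
    proof
      fix x assume "x \<in> D"
      have "(\<Sum>i<N. (c(N := t)) i * z i x) = (\<Sum>i<N. c i * y i x)"
        by (rule sum.cong) (auto simp: z_def)
      with t[OF \<open>x \<in> D\<close>] show "f x = (\<Sum>i<Suc N. (c(N := t)) i * z i x)"
        by (simp add: z_def algebra_simps)
    qed
    then show ?thesis by blast
  qed
  moreover have "\<forall>i<Suc N. z i \<in> V"
    using y u(1) by (auto simp: z_def V'_def less_Suc_eq)
  ultimately show ?case by blast
qed

section \<open>Bounded operators on the Hardy space\<close>

lemma bounded_op_H2: "h2_bounded_op T \<Longrightarrow> f \<in> H2 \<Longrightarrow> T f \<in> H2"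
  by (simp add: h2_bounded_op_def)

lemma bounded_op_linear:
  "h2_bounded_op T \<Longrightarrow> f \<in> H2 \<Longrightarrow> g \<in> H2 \<Longrightarrow> z \<in> ball 0 1 \<Longrightarrow>
    T (\<lambda>x. a * f x + g x) z = a * T f z + T g z"
  unfolding h2_bounded_op_def by blast

lemma bounded_op_zero:
  assumes "h2_bounded_op T" "z \<in> ball 0 1"
  shows "T (\<lambda>x. 0) z = 0"
  using bounded_op_linear[OF assms(1) H2_zero H2_zero assms(2), of 1] by simp

lemma bounded_op_cmult:
  assumes "h2_bounded_op T" "f \<in> H2" "z \<in> ball 0 1"
  shows "T (\<lambda>x. a * f x) z = a * T f z"
  using bounded_op_linear[OF assms(1,2) H2_zero assms(3), of a] bounded_op_zero[OF assms(1,3)] by simp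

lemma bounded_op_polynomial:
  assumes "h2_bounded_op T" "z \<in> ball 0 1"
  shows "T (\<lambda>x. \<Sum>n<M. t n * x ^ n) z = (\<Sum>n<M. t n * T (\<lambda>x. x ^ n) z)"
proof (induction M)
  case 0
  then show ?case using bounded_op_zero[OF assms] by simp
next
  case (Suc M)
  have "T (\<lambda>x. t M * x ^ M + (\<Sum>n<M. t n * x ^ n)) z
      = t M * T (\<lambda>x. x ^ M) z + T (\<lambda>x. \<Sum>n<M. t n * x ^ n) z"
    using assms by (intro bounded_op_linear H2_power H2_polynomial)
  with Suc show ?case by (simp add: add.commute)
qed

lemma bounded_op_square_bound:
  assumes "h2_bounded_op T"
  obtains C where "0 \<le> C" and "\<And>f. f \<in> H2 \<Longrightarrow> (h2_norm (T f))\<^sup>2 \<le> C * (h2_norm f)\<^sup>2"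
proof -
  obtain C where C: "\<And>f. f \<in> H2 \<Longrightarrow> h2_norm (T f) \<le> C * h2_norm f"
    using assms unfolding h2_bounded_op_def by blast
  have "(h2_norm (T f))\<^sup>2 \<le> C\<^sup>2 * (h2_norm f)\<^sup>2" if "f \<in> H2" for f
    unfolding power_mult_distrib[symmetric]
    using C[OF that] h2_norm_nonneg[OF bounded_op_H2[OF assms that]] by (intro power_mono)
  then show ?thesis using that[of "C\<^sup>2"] by simp
qed

lemma bounded_opI:
  assumes "\<And>f. f \<in> H2 \<Longrightarrow> T f \<in> H2"
    and "\<And>f g a z. f \<in> H2 \<Longrightarrow> g \<in> H2 \<Longrightarrow> z \<in> ball 0 1 \<Longrightarrow>
      T (\<lambda>x. a * f x + g x) z = a * T f z + T g z"
    and "0 \<le> C" "\<And>f. f \<in> H2 \<Longrightarrow> (h2_norm (T f))\<^sup>2 \<le> C * (h2_norm f)\<^sup>2"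
  shows "h2_bounded_op T"
proof -
  have "h2_norm (T f) \<le> sqrt C * h2_norm f" if "f \<in> H2" for f
  proof (rule power2_le_imp_le)
    show "(h2_norm (T f))\<^sup>2 \<le> (sqrt C * h2_norm f)\<^sup>2"
      using assms(3,4) that by (simp add: power_mult_distrib)
    show "0 \<le> sqrt C * h2_norm f" using assms(3) h2_norm_nonneg[OF that] by simp
  qed
  then show ?thesis using assms(1,2) unfolding h2_bounded_op_def by blast
qed

lemma bounded_op_diff:
  assumes "h2_bounded_op T" "h2_bounded_op R"
  shows "h2_bounded_op (\<lambda>f z. T f z - R f z)"
proof -
  obtain C where C: "0 \<le> C" "\<And>f. f \<in> H2 \<Longrightarrow> (h2_norm (T f))\<^sup>2 \<le> C * (h2_norm f)\<^sup>2"
    using bounded_op_square_bound[OF assms(1)] by blast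
  obtain C' where C': "0 \<le> C'" "\<And>f. f \<in> H2 \<Longrightarrow> (h2_norm (R f))\<^sup>2 \<le> C' * (h2_norm f)\<^sup>2"
    using bounded_op_square_bound[OF assms(2)] by blast
  show ?thesis
  proof (rule bounded_opI[of _ "2 * C + 2 * C'"])
    fix f assume f: "f \<in> H2"
    show "(\<lambda>z. T f z - R f z) \<in> H2"
      by (rule H2_diff(1)[OF bounded_op_H2[OF assms(1) f] bounded_op_H2[OF assms(2) f]])
    have "(h2_norm (\<lambda>z. T f z - R f z))\<^sup>2 \<le> 2 * (h2_norm (T f))\<^sup>2 + 2 * (h2_norm (R f))\<^sup>2"
      by (rule H2_diff(2)[OF bounded_op_H2[OF assms(1) f] bounded_op_H2[OF assms(2) f]])
    then show "(h2_norm (\<lambda>z. T f z - R f z))\<^sup>2 \<le> (2 * C + 2 * C') * (h2_norm f)\<^sup>2"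
      using C(2)[OF f] C'(2)[OF f] by (simp add: algebra_simps)
    show "T (\<lambda>x. a * f x + g x) z - R (\<lambda>x. a * f x + g x) z = a * (T f z - R f z) + (T g z - R g z)"
      if "g \<in> H2" "z \<in> ball 0 1" for g a z
      unfolding bounded_op_linear[OF assms(1) f that] bounded_op_linear[OF assms(2) f that]
      by (simp add: algebra_simps)
  qed (use C C' in simp)
qed

text \<open>Boundedness makes the set of values bounded above, so the supremum is a true upper bound
  on the unit ball; scaling extends it to all of \<open>H2\<close>. Functions of norm zero cannot be
  scaled and are handled by the bound from the definition of a bounded operator.\<close>

lemma op_norm_bound:
  assumes T: "h2_bounded_op T"
  shows "0 \<le> h2_op_norm T" and "\<And>f. f \<in> H2 \<Longrightarrow> h2_norm (T f) \<le> h2_op_norm T * h2_norm f"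
proof -
  obtain C where C: "\<And>f. f \<in> H2 \<Longrightarrow> h2_norm (T f) \<le> C * h2_norm f"
    using T unfolding h2_bounded_op_def by blast
  have "h2_norm (T f) \<le> \<bar>C\<bar>" if "f \<in> H2" "h2_norm f \<le> 1" for f
  proof -
    have "h2_norm (T f) \<le> C * h2_norm f" by (rule C[OF that(1)])
    also have "\<dots> \<le> \<bar>C\<bar> * h2_norm f" by (intro mult_right_mono h2_norm_nonneg that) simp
    also have "\<dots> \<le> \<bar>C\<bar>" using that by (simp add: mult_left_le)
    finally show ?thesis .
  qed
  then have "bdd_above {h2_norm (T f) | f. f \<in> H2 \<and> h2_norm f \<le> 1}"
    by (intro bdd_aboveI[of _ "\<bar>C\<bar>"]) auto
  then have upper: "h2_norm (T f) \<le> h2_op_norm T" if "f \<in> H2" "h2_norm f \<le> 1" for f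
    unfolding h2_op_norm_def using that by (intro cSup_upper) auto
  show "0 \<le> h2_op_norm T"
    using upper[OF H2_zero] h2_norm_nonneg[OF bounded_op_H2[OF T H2_zero]] by (simp add: h2_norm_zero)
  fix f assume f: "f \<in> H2"
  show "h2_norm (T f) \<le> h2_op_norm T * h2_norm f"
  proof (cases "h2_norm f = 0")
    case True
    then show ?thesis using C[OF f] by simp
  next
    case False
    then have pos: "h2_norm f > 0" using h2_norm_nonneg[OF f] by simp
    define a where "a = complex_of_real (1 / h2_norm f)"
    have "h2_norm (\<lambda>z. a * f z) = 1"
      unfolding H2_cmult(2)[OF f] a_def using pos by (simp add: norm_divide)
    then have "h2_norm (T (\<lambda>z. a * f z)) \<le> h2_op_norm T"
      by (intro upper H2_cmult f) simp
    moreover have "h2_norm (T (\<lambda>z. a * f z)) = h2_norm (\<lambda>z. a * T f z)"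
      by (intro h2_norm_cong bounded_op_cmult T f)
    moreover have "\<dots> = h2_norm (T f) / h2_norm f"
      unfolding H2_cmult(2)[OF bounded_op_H2[OF T f]] a_def using pos by (simp add: norm_divide)
    ultimately show ?thesis using pos by (simp add: field_simps)
  qed
qed

text \<open>Applies \<open>finite_rank_hilbert_schmidt_bound\<close> to finite blocks of the matrix
  of \<open>R\<close> in the monomial basis; polynomials supply the test vectors for the norm
  bound.\<close>

lemma finite_rank_sum_norm_basis:
  assumes R: "h2_bounded_op R" and rank: "h2_rank_le R N" and "0 \<le> K"
    and K: "\<And>f. f \<in> H2 \<Longrightarrow> (h2_norm (R f))\<^sup>2 \<le> K * (h2_norm f)\<^sup>2"
  shows "(\<Sum>n<M. (h2_norm (R (\<lambda>z. z ^ n)))\<^sup>2) \<le> real N * K"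
proof -
  \<comment> \<open>Linearity of \<open>R\<close> is an identity on the disk only, so the range is
    enlarged to all functions that agree there with some \<open>R f\<close>; this set is closed
    under linear combinations.\<close>
  define V where "V = {h. \<exists>f\<in>H2. \<forall>z\<in>ball 0 1. h z = R f z}"
  obtain b where b: "\<And>f. f \<in> H2 \<Longrightarrow> \<exists>c. \<forall>z\<in>ball 0 1. R f z = (\<Sum>i<N. c i * b i z)"
    using rank unfolding h2_rank_le_def by blast
  have V: "R f \<in> V" if "f \<in> H2" for f
    unfolding V_def using that by blast
  have V_hol: "h holomorphic_on ball 0 1" if h: "h \<in> V" for h
  proof -
    obtain f where f: "f \<in> H2" "\<And>z. z \<in> ball 0 1 \<Longrightarrow> h z = R f z"
      using h unfolding V_def by blast
    have "R f holomorphic_on ball 0 1"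
      by (rule H2_holomorphic[OF bounded_op_H2[OF R f(1)]])
    then show ?thesis by (rule holomorphic_transform) (simp add: f(2))
  qed
  have "\<exists>y. (\<forall>i<N. y i \<in> V) \<and> (\<forall>f\<in>V. \<exists>c. \<forall>z\<in>ball 0 1. f z = (\<Sum>i<N. c i * y i z))"
  proof (rule subspace_spanned_by_members)
    show "V \<noteq> {}" using V[OF H2_zero] by blast
    show "(\<lambda>x. a * f x + g x) \<in> V" if fg: "f \<in> V" "g \<in> V" for f g a
    proof -
      obtain f' g' where f': "f' \<in> H2" "\<And>z. z \<in> ball 0 1 \<Longrightarrow> f z = R f' z"
        and g': "g' \<in> H2" "\<And>z. z \<in> ball 0 1 \<Longrightarrow> g z = R g' z"
        using fg unfolding V_def by blast
      have "(\<lambda>x. a * f' x + g' x) \<in> H2"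
        by (intro H2_add H2_cmult f' g')
      moreover have "\<forall>z\<in>ball 0 1. a * f z + g z = R (\<lambda>x. a * f' x + g' x) z"
        using bounded_op_linear[OF R f'(1) g'(1)] f'(2) g'(2) by simp
      ultimately show ?thesis unfolding V_def by blast
    qed
    show "\<exists>c. \<forall>x\<in>ball 0 1. f x = (\<Sum>i<N. c i * b i x)" if "f \<in> V" for f
      using that b unfolding V_def by fastforce
  qed
  then obtain y where y: "\<And>i. i < N \<Longrightarrow> y i \<in> V"
    and sp: "\<And>f. f \<in> V \<Longrightarrow> \<exists>c. \<forall>z\<in>ball 0 1. f z = (\<Sum>i<N. c i * y i z)"
    by blast
  have "\<forall>n. \<exists>c. \<forall>z\<in>ball 0 1. R (\<lambda>z. z ^ n) z = (\<Sum>i<N. c i * y i z)"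
    using sp[OF V[OF H2_power]] by blast
  then obtain c where c: "\<And>n z. z \<in> ball 0 1 \<Longrightarrow> R (\<lambda>z. z ^ n) z = (\<Sum>i<N. c n i * y i z)"
    by metis
  define x where "x n = taylor_coeff (R (\<lambda>z. z ^ n))" for n
  have Rhol: "R (\<lambda>z. z ^ n) holomorphic_on ball 0 1" for n
    by (rule H2_holomorphic[OF bounded_op_H2[OF R H2_power]])
  have partial: "(\<Sum>n<M. \<Sum>k<L. (cmod (x n k))\<^sup>2) \<le> real N * K" for L
  proof (rule finite_rank_hilbert_schmidt_bound[OF \<open>0 \<le> K\<close>])
    show "x n k = (\<Sum>i<N. c n i * taylor_coeff (y i) k)" for n k
    proof -
      have "x n k = taylor_coeff (\<lambda>z. \<Sum>i<N. c n i * y i z) k"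
        unfolding x_def by (rule taylor_coeff_cong) (rule c)
      also have "\<dots> = (\<Sum>i<N. taylor_coeff (\<lambda>z. c n i * y i z) k)"
        by (rule taylor_coeff_sum) (use V_hol[OF y] in \<open>auto intro!: holomorphic_intros\<close>)
      also have "\<dots> = (\<Sum>i<N. c n i * taylor_coeff (y i) k)"
        by (intro sum.cong) (auto simp: taylor_coeff_cmult V_hol y)
      finally show ?thesis .
    qed
    fix t :: "nat \<Rightarrow> complex"
    define q where "q = (\<lambda>z. \<Sum>n<M. t n * z ^ n)"
    have q: "q \<in> H2" "(h2_norm q)\<^sup>2 = (\<Sum>n<M. (cmod (t n))\<^sup>2)"
      unfolding q_def by (rule H2_polynomial)+
    have "(\<Sum>n<M. t n * x n k) = taylor_coeff (R q) k" for k
    proof -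
      have "taylor_coeff (R q) k = taylor_coeff (\<lambda>z. \<Sum>n<M. t n * R (\<lambda>z. z ^ n) z) k"
        unfolding q_def by (rule taylor_coeff_cong) (rule bounded_op_polynomial[OF R])
      also have "\<dots> = (\<Sum>n<M. taylor_coeff (\<lambda>z. t n * R (\<lambda>z. z ^ n) z) k)"
        by (rule taylor_coeff_sum) (intro holomorphic_intros Rhol)
      finally show ?thesis by (simp add: taylor_coeff_cmult Rhol x_def)
    qed
    then have "(\<Sum>k<L. (cmod (\<Sum>n<M. t n * x n k))\<^sup>2) \<le> (h2_norm (R q))\<^sup>2"
      by (simp add: sum_taylor_coeff_le bounded_op_H2[OF R q(1)])
    also have "\<dots> \<le> K * (\<Sum>n<M. (cmod (t n))\<^sup>2)" using K[OF q(1)] q(2) by simp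
    finally show "(\<Sum>k<L. (cmod (\<Sum>n<M. t n * x n k))\<^sup>2) \<le> K * (\<Sum>n<M. (cmod (t n))\<^sup>2)" .
  qed
  have "(\<lambda>L. \<Sum>n<M. \<Sum>k<L. (cmod (x n k))\<^sup>2) \<longlonglongrightarrow> (\<Sum>n<M. (h2_norm (R (\<lambda>z. z ^ n)))\<^sup>2)"
    unfolding x_def h2_norm_square[OF bounded_op_H2[OF R H2_power]]
    by (intro tendsto_sum summable_LIMSEQ H2_summable[OF bounded_op_H2[OF R H2_power]])
  then show ?thesis
    by (rule LIMSEQ_le_const2) (use partial in auto)
qed

section \<open>Approximation numbers and Hilbert--Schmidt sums\<close>

lemma rank_le_mono:
  assumes "h2_rank_le R m" "m \<le> n"
  shows "h2_rank_le R n"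
proof -
  obtain b where b: "\<And>f. f \<in> H2 \<Longrightarrow> \<exists>c. \<forall>z\<in>ball 0 1. R f z = (\<Sum>i<m. c i * b i z)"
    using assms(1) unfolding h2_rank_le_def by blast
  have "\<exists>c. \<forall>z\<in>ball 0 1. R f z = (\<Sum>i<n. c i * b i z)" if f: "f \<in> H2" for f
  proof -
    obtain c where c: "\<And>z. z \<in> ball 0 1 \<Longrightarrow> R f z = (\<Sum>i<m. c i * b i z)"
      using b[OF f] by blast
    have "(\<Sum>i<n. (if i < m then c i else 0) * b i z) = (\<Sum>i<m. c i * b i z)" for z
      using assms(2) by (intro sum.mono_neutral_cong_right) auto
    with c show ?thesis by (intro exI[of _ "\<lambda>i. if i < m then c i else 0"]) simp
  qed
  then show ?thesis unfolding h2_rank_le_def by blast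
qed

lemma zero_op: "h2_bounded_op (\<lambda>f z. 0)" "h2_rank_le (\<lambda>f z. 0) n"
proof -
  show "h2_bounded_op (\<lambda>f z. 0)"
    by (rule bounded_opI[of _ 0]) (simp_all add: H2_zero h2_norm_zero)
  show "h2_rank_le (\<lambda>f z. 0) n"
    unfolding h2_rank_le_def by (auto intro!: exI[of _ "\<lambda>_. 0"])
qed

text \<open>The zero operator makes each set of distances nonempty, and distances are nonnegative,
  so the infimum is genuine; the sets grow with the permitted rank.\<close>

lemma singular_num_properties:
  assumes T: "h2_bounded_op T"
  shows singular_num_nonneg: "0 \<le> singular_num T n"
    and singular_num_antimono: "m \<le> n \<Longrightarrow> singular_num T n \<le> singular_num T m"
    and singular_num_approx: "singular_num T n < e \<Longrightarrow>
      \<exists>R. h2_bounded_op R \<and> h2_rank_le R n \<and> h2_op_norm (\<lambda>f z. T f z - R f z) < e"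
proof -
  define X where "X n = {h2_op_norm (\<lambda>f z. T f z - R f z) | R. h2_bounded_op R \<and> h2_rank_le R n}" for n
  have ne: "X n \<noteq> {}" for n unfolding X_def using zero_op by blast
  have nonneg: "0 \<le> u" if "u \<in> X n" for u n
    using that unfolding X_def by (auto intro!: op_norm_bound bounded_op_diff T)
  show "0 \<le> singular_num T n"
    unfolding singular_num_def X_def[symmetric] by (intro cInf_greatest ne nonneg)
  show "singular_num T n \<le> singular_num T m" if "m \<le> n"
    unfolding singular_num_def X_def[symmetric]
  proof (intro cInf_superset_mono ne)
    show "bdd_below (X n)" using nonneg by (intro bdd_belowI[of _ 0])
    show "X m \<subseteq> X n" unfolding X_def using rank_le_mono[OF _ that] by blast
  qed
  show "\<exists>R. h2_bounded_op R \<and> h2_rank_le R n \<and> h2_op_norm (\<lambda>f z. T f z - R f z) < e"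
    if "singular_num T n < e"
    using cInf_lessD[OF ne[of n], of e] that unfolding singular_num_def X_def[symmetric] by (auto simp: X_def)
qed

text \<open>Split \<open>T = A + R\<close> with \<open>R\<close> of rank at most \<open>N\<close>
  and \<open>A\<close> of norm below \<open>e\<close>: each of the \<open>M\<close> monomials costs
  at most \<open>e^2\<close> through \<open>A\<close>, while \<open>R\<close> costs at most
  \<open>N\<close> times a bound on its squared norm, independently of \<open>M\<close>.\<close>

lemma sum_norm_basis_le_singular_num:
  assumes T: "h2_bounded_op T" and e: "singular_num T N < e" and "0 \<le> C"
    and C: "\<And>f. f \<in> H2 \<Longrightarrow> (h2_norm (T f))\<^sup>2 \<le> C * (h2_norm f)\<^sup>2"
  shows "(\<Sum>n<M. (h2_norm (T (\<lambda>z. z ^ n)))\<^sup>2) \<le> 2 * real M * e\<^sup>2 + 2 * real N * (2 * C + 2 * e\<^sup>2)"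
proof -
  obtain R where R: "h2_bounded_op R" "h2_rank_le R N" and lt: "h2_op_norm (\<lambda>f z. T f z - R f z) < e"
    using singular_num_approx[OF T e] by blast
  define A where "A = (\<lambda>f z. T f z - R f z)"
  have A: "h2_bounded_op A" unfolding A_def by (intro bounded_op_diff T R)
  have A_le: "(h2_norm (A f))\<^sup>2 \<le> e\<^sup>2 * (h2_norm f)\<^sup>2" if f: "f \<in> H2" for f
  proof -
    have "h2_norm (A f) \<le> h2_op_norm A * h2_norm f" by (rule op_norm_bound(2)[OF A f])
    also have "\<dots> \<le> e * h2_norm f"
      using lt by (intro mult_right_mono h2_norm_nonneg f) (simp add: A_def)
    finally show ?thesis
      unfolding power_mult_distrib[symmetric] by (rule power_mono) (rule h2_norm_nonneg[OF bounded_op_H2[OF A f]])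
  qed
  have "(h2_norm (R f))\<^sup>2 \<le> (2 * C + 2 * e\<^sup>2) * (h2_norm f)\<^sup>2" if f: "f \<in> H2" for f
  proof -
    have "R f = (\<lambda>z. T f z - A f z)" by (simp add: A_def)
    then have "(h2_norm (R f))\<^sup>2 \<le> 2 * (h2_norm (T f))\<^sup>2 + 2 * (h2_norm (A f))\<^sup>2"
      using H2_diff(2)[OF bounded_op_H2[OF T f] bounded_op_H2[OF A f]] by simp
    then show ?thesis using C[OF f] A_le[OF f] by (simp add: algebra_simps)
  qed
  then have Rsum: "(\<Sum>n<M. (h2_norm (R (\<lambda>z. z ^ n)))\<^sup>2) \<le> real N * (2 * C + 2 * e\<^sup>2)"
    using R \<open>0 \<le> C\<close> by (intro finite_rank_sum_norm_basis) auto
  have "(h2_norm (T (\<lambda>z. z ^ n)))\<^sup>2 \<le> 2 * e\<^sup>2 + 2 * (h2_norm (R (\<lambda>z. z ^ n)))\<^sup>2" for n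
  proof -
    have "T (\<lambda>z. z ^ n) = (\<lambda>z. A (\<lambda>z. z ^ n) z + R (\<lambda>z. z ^ n) z)" by (simp add: A_def)
    then have "(h2_norm (T (\<lambda>z. z ^ n)))\<^sup>2 \<le> 2 * (h2_norm (A (\<lambda>z. z ^ n)))\<^sup>2 + 2 * (h2_norm (R (\<lambda>z. z ^ n)))\<^sup>2"
      using H2_add(2)[OF bounded_op_H2[OF A H2_power] bounded_op_H2[OF R(1) H2_power]] by simp
    then show ?thesis using A_le[OF H2_power, of n] by (simp add: h2_norm_power)
  qed
  then have "(\<Sum>n<M. (h2_norm (T (\<lambda>z. z ^ n)))\<^sup>2) \<le> (\<Sum>n<M. 2 * e\<^sup>2 + 2 * (h2_norm (R (\<lambda>z. z ^ n)))\<^sup>2)"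
    by (intro sum_mono)
  also have "\<dots> = 2 * real M * e\<^sup>2 + 2 * (\<Sum>n<M. (h2_norm (R (\<lambda>z. z ^ n)))\<^sup>2)"
    by (simp add: sum.distrib sum_distrib_left)
  finally show ?thesis using Rsum by simp
qed

text \<open>By monotonicity the first \<open>2 ^ i\<close> terms are each at least the term at
  \<open>2 ^ i\<close>, so \<open>2 ^ i * s (2 ^ i) powr p\<close> is at most the whole sum; then
  take p-th roots.\<close>

lemma antimono_powr_summable_decay:
  fixes s :: "nat \<Rightarrow> real"
  assumes "0 < p" and nonneg: "\<And>n. 0 \<le> s n" and mono: "\<And>m n. m \<le> n \<Longrightarrow> s n \<le> s m"
    and sm: "summable (\<lambda>n. s n powr p)"
  obtains B \<rho> where "0 < B" "0 < \<rho>" "\<rho> < 1" "\<And>i. s (2 ^ i) < B * \<rho> ^ i"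
proof
  define \<Sigma> where "\<Sigma> = (\<Sum>n. s n powr p)"
  \<comment> \<open>Adding 1 keeps \<open>B\<close> positive and makes the final inequality
    strict.\<close>
  define B where "B = (\<Sigma> + 1) powr (1 / p)"
  define \<rho> where "\<rho> = (2::real) powr (- 1 / p)"
  have \<Sigma>: "0 \<le> \<Sigma>" unfolding \<Sigma>_def by (intro suminf_nonneg sm) simp
  show "0 < B" "0 < \<rho>" using \<Sigma> by (simp_all add: B_def \<rho>_def)
  show "\<rho> < 1" using powr_less_mono[of "- 1 / p" 0 2] \<open>0 < p\<close> by (simp add: \<rho>_def)
  fix i :: nat
  have "2 ^ i * s (2 ^ i) powr p = (\<Sum>n<(2::nat) ^ i. s (2 ^ i) powr p)" by simp
  also have "\<dots> \<le> (\<Sum>n<(2::nat) ^ i. s n powr p)"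
    using nonneg mono \<open>0 < p\<close> by (intro sum_mono powr_mono2) auto
  also have "\<dots> \<le> \<Sigma>" unfolding \<Sigma>_def by (intro sum_le_suminf sm) auto
  finally have le: "s (2 ^ i) powr p < (\<Sigma> + 1) / 2 ^ i" by (simp add: field_simps)
  have "(B * \<rho> ^ i) powr p = B powr p * (\<rho> powr p) ^ i"
    using \<open>0 < B\<close> \<open>0 < \<rho>\<close> by (simp add: powr_mult powr_realpow[symmetric] powr_powr mult.commute)
  also have "\<rho> powr p = 1 / 2"
    unfolding \<rho>_def powr_powr using \<open>0 < p\<close> by (simp add: powr_minus_divide)
  also have "B powr p * (1 / 2) ^ i = (\<Sigma> + 1) / 2 ^ i"
    using \<open>0 < p\<close> \<Sigma> by (simp add: B_def powr_powr power_divide)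
  finally have "s (2 ^ i) powr p < (B * \<rho> ^ i) powr p" using le by simp
  then show "s (2 ^ i) < B * \<rho> ^ i"
    using \<open>0 < p\<close> \<open>0 < B\<close> \<open>0 < \<rho>\<close> by (meson linorder_not_le powr_mono2 less_imp_le mult_nonneg_nonneg zero_le_power)
qed

text \<open>Use rank \<open>2 ^ i\<close> against \<open>4 ^ i\<close> basis vectors: the
  approximation error contributes order \<open>4 ^ i * \<rho> ^ (2 * i)\<close>, the finite rank
  part order \<open>2 ^ i\<close>. Both grow more slowly than \<open>4 ^ i\<close>.\<close>

lemma schatten_sum_norm_basis_decay:
  assumes "schatten p T" "0 < p"
  obtains A \<theta> where "0 < A" "0 < \<theta>" "\<theta> < 1"
    "\<And>i. (\<Sum>n<4 ^ i. (h2_norm (T (\<lambda>z. z ^ n)))\<^sup>2) \<le> A * (4 * \<theta>) ^ i"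
proof -
  have T: "h2_bounded_op T" and sm: "summable (\<lambda>n. singular_num T n powr p)"
    using assms(1) by (auto simp: schatten_def)
  obtain C where C: "0 \<le> C" "\<And>f. f \<in> H2 \<Longrightarrow> (h2_norm (T f))\<^sup>2 \<le> C * (h2_norm f)\<^sup>2"
    using bounded_op_square_bound[OF T] by blast
  obtain B \<rho> where B: "0 < B" and \<rho>: "0 < \<rho>" "\<rho> < 1" and s: "\<And>i. singular_num T (2 ^ i) < B * \<rho> ^ i"
    using antimono_powr_summable_decay[OF \<open>0 < p\<close> singular_num_nonneg[OF T] singular_num_antimono[OF T] sm]
    by blast
  \<comment> \<open>The two entries absorb the approximation error and the finite rank part:
    \<open>\<rho>\<^sup>2 \<le> \<theta>\<close> and \<open>2 \<le> 4 * \<theta>\<close>.\<close>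
  define \<theta> where "\<theta> = max (\<rho>\<^sup>2) (1 / 2)"
  have \<theta>: "0 < \<theta>" "\<theta> < 1" "\<rho>\<^sup>2 \<le> \<theta>" "1 / 2 \<le> \<theta>"
    using \<rho> by (auto simp: \<theta>_def abs_square_less_1)
  define A where "A = 2 * B\<^sup>2 + 2 * (2 * C + 2 * B\<^sup>2)"
  show thesis
  proof (rule that[of A \<theta>])
    show "0 < A" using B C by (simp add: A_def add_pos_nonneg)
    fix i :: nat
    have e2: "(B * \<rho> ^ i)\<^sup>2 = B\<^sup>2 * (\<rho>\<^sup>2) ^ i"
      by (simp add: power_mult_distrib power_mult[symmetric] mult.commute)
    have "(\<rho>\<^sup>2) ^ i \<le> 1" using \<rho> by (simp add: power_le_one)
    then have e2_le: "(B * \<rho> ^ i)\<^sup>2 \<le> B\<^sup>2" unfolding e2 by (simp add: mult_left_le)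
    have \<rho>_pow: "(\<rho>\<^sup>2) ^ i \<le> \<theta> ^ i" using \<theta> by (intro power_mono) auto
    have two_pow: "(2::real) ^ i \<le> (4 * \<theta>) ^ i" using \<theta> by (intro power_mono) auto
    have "(\<Sum>n<4 ^ i. (h2_norm (T (\<lambda>z. z ^ n)))\<^sup>2)
        \<le> 2 * real (4 ^ i) * (B * \<rho> ^ i)\<^sup>2 + 2 * real (2 ^ i) * (2 * C + 2 * (B * \<rho> ^ i)\<^sup>2)"
      by (rule sum_norm_basis_le_singular_num[OF T s C])
    also have "\<dots> \<le> 2 * B\<^sup>2 * (4 * \<theta>) ^ i + 2 * (4 * \<theta>) ^ i * (2 * C + 2 * B\<^sup>2)"
    proof (rule add_mono)
      have "4 ^ i * (\<rho>\<^sup>2) ^ i \<le> (4 * \<theta>) ^ i"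
        unfolding power_mult_distrib using \<rho>_pow by simp
      from mult_left_mono[OF this, of "2 * B\<^sup>2"]
      show "2 * real (4 ^ i) * (B * \<rho> ^ i)\<^sup>2 \<le> 2 * B\<^sup>2 * (4 * \<theta>) ^ i"
        unfolding e2 by (simp add: mult_ac)
      show "2 * real (2 ^ i) * (2 * C + 2 * (B * \<rho> ^ i)\<^sup>2) \<le> 2 * (4 * \<theta>) ^ i * (2 * C + 2 * B\<^sup>2)"
        using two_pow e2_le C \<theta> by (intro mult_mono) auto
    qed
    also have "\<dots> = A * (4 * \<theta>) ^ i" by (simp add: A_def algebra_simps)
    finally show "(\<Sum>n<4 ^ i. (h2_norm (T (\<lambda>z. z ^ n)))\<^sup>2) \<le> A * (4 * \<theta>) ^ i" .
  qed (use \<theta> in auto)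
qed

section \<open>Weighted composition operators\<close>

text \<open>Summing Bernoulli's inequality \<open>1 - n * (1 - x) \<le> x ^ n\<close> loses at most
  half of \<open>M\<close> as long as \<open>M * (1 - x)\<close> is at most 1.\<close>

lemma geometric_sum_ge_half:
  fixes x :: real
  assumes "0 \<le> x" "real M * (1 - x) \<le> 1"
  shows "real M / 2 \<le> (\<Sum>n<M. x ^ n)"
proof (cases "x \<le> 1")
  case True
  have "real M - real M * (real M - 1) / 2 * (1 - x) \<le> (\<Sum>n<M. x ^ n)"
  proof (induction M)
    case (Suc M)
    have "1 - real M * (1 - x) \<le> x ^ M"
      using Bernoulli_inequality[of "x - 1" M] assms(1) by (simp add: algebra_simps)
    with Suc show ?case by (simp add: field_simps)
  qed simp
  moreover have "real M * (real M - 1) / 2 * (1 - x) \<le> real M / 2"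
  proof (cases "M = 0")
    case False
    then have "(real M * (1 - x)) * ((real M - 1) / 2) \<le> 1 * ((real M - 1) / 2)"
      by (intro mult_right_mono assms) auto
    then show ?thesis by (simp add: field_simps)
  qed simp
  ultimately show ?thesis by linarith
next
  case False
  then have "(\<Sum>n<M. 1) \<le> (\<Sum>n<M. x ^ n)" by (intro sum_mono) simp
  then show ?thesis by simp
qed

text \<open>Selects the power of 4 comparable to \<open>1 / (1 - x)\<close>: the predecessor of the
  least exponent with \<open>1 < 4 ^ m * (1 - x)\<close>. That exponent is nonzero because
  \<open>1 - x \<le> 1\<close>.\<close>

lemma scale_selection:
  fixes x :: real
  assumes "0 \<le> x" "x < 1"
  obtains i :: nat where "4 ^ i * (1 - x) \<le> 1" "1 < 4 ^ Suc i * (1 - x)"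
proof -
  obtain m where "1 / (1 - x) < 4 ^ m"
    using real_arch_pow[of 4 "1 / (1 - x)"] by auto
  then have ex: "1 < 4 ^ m * (1 - x)" using assms by (simp add: field_simps)
  define k where "k = (LEAST m. 1 < 4 ^ m * (1 - x))"
  have k: "1 < 4 ^ k * (1 - x)" unfolding k_def using ex by (rule LeastI)
  then have "k \<noteq> 0" using assms by (cases k) auto
  then obtain i where i: "k = Suc i" using not0_implies_Suc by blast
  then have "\<not> 1 < 4 ^ i * (1 - x)" unfolding k_def by (metis lessI not_less_Least)
  then show ?thesis using that[of i] k i by simp
qed

lemma power_div_fact_le_exp:
  fixes u :: real
  assumes "0 \<le> u"
  shows "u ^ k / fact k \<le> exp u"
proof -
  have "(\<Sum>n\<in>{k}. u ^ n /\<^sub>R fact n) \<le> (\<Sum>n. u ^ n /\<^sub>R fact n)"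
    using assms by (intro sum_le_suminf summable_exp_generic) auto
  then show ?thesis by (simp add: exp_def divide_inverse mult.commute)
qed

text \<open>The factor \<open>1 - (cmod (\<phi> z))\<^sup>2\<close> cancels the growth of
  \<open>f (\<phi> z)\<close>, so images of \<open>H2\<close> functions are bounded. It also cancels
  the geometric series formed by the images of the monomials, which bounds the Hilbert--Schmidt sum
  by \<open>C\<close>.\<close>

lemma hilbert_schmidt_wcomp:
  assumes \<phi>: "\<phi> holomorphic_on ball 0 1" "\<phi> ` ball 0 1 \<subseteq> ball 0 1"
    and v: "v holomorphic_on ball 0 1"
    and C: "\<And>z. z \<in> ball 0 1 \<Longrightarrow> (cmod (v z))\<^sup>2 \<le> C * (1 - (cmod (\<phi> z))\<^sup>2)"
  shows "hilbert_schmidt (wcomp v \<phi>)"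
proof -
  have pos: "0 < 1 - (cmod (\<phi> z))\<^sup>2" if "z \<in> ball 0 1" for z
    using \<phi>(2) that by (auto simp: image_subset_iff abs_square_less_1)
  have "0 \<le> C"
  proof -
    have "0 \<le> C * (1 - (cmod (\<phi> 0))\<^sup>2)" by (rule order_trans[OF _ C]) auto
    then show ?thesis using pos[of 0] by (simp add: zero_le_mult_iff)
  qed
  have hol: "wcomp v \<phi> f holomorphic_on ball 0 1" if "f \<in> H2" for f
  proof -
    have "(f \<circ> \<phi>) holomorphic_on ball 0 1"
      using holomorphic_on_compose_gen[OF \<phi>(1) H2_holomorphic[OF that]] \<phi>(2) by blast
    then show ?thesis unfolding wcomp_def o_def by (intro holomorphic_intros v)
  qed
  have bound: "wcomp v \<phi> f \<in> H2 \<and> (h2_norm (wcomp v \<phi> f))\<^sup>2 \<le> C * (h2_norm f)\<^sup>2" if f: "f \<in> H2" for f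
  proof -
    have "(cmod (wcomp v \<phi> f z))\<^sup>2 \<le> C * (h2_norm f)\<^sup>2" if z: "z \<in> ball 0 1" for z
    proof -
      have "(cmod (wcomp v \<phi> f z))\<^sup>2 = (cmod (v z))\<^sup>2 * (cmod (f (\<phi> z)))\<^sup>2"
        by (simp add: wcomp_def norm_mult power_mult_distrib)
      also have "\<dots> \<le> (C * (1 - (cmod (\<phi> z))\<^sup>2)) * (cmod (f (\<phi> z)))\<^sup>2"
        by (intro mult_right_mono C z) simp
      also have "\<dots> = C * ((cmod (f (\<phi> z)))\<^sup>2 * (1 - (cmod (\<phi> z))\<^sup>2))" by simp
      also have "\<dots> \<le> C * (h2_norm f)\<^sup>2"
        using \<phi>(2) z \<open>0 \<le> C\<close> by (intro mult_left_mono H2_pointwise_bound f) blast+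
      finally show ?thesis .
    qed
    then show ?thesis
      using H2_bounded_family[of "{()}" "\<lambda>_. wcomp v \<phi> f" "C * (h2_norm f)\<^sup>2"] hol[OF f] by simp
  qed
  have op: "h2_bounded_op (wcomp v \<phi>)"
    by (rule bounded_opI[OF _ _ \<open>0 \<le> C\<close>]) (use bound in \<open>auto simp: wcomp_def algebra_simps\<close>)
  have "(\<Sum>n<M. (h2_norm (wcomp v \<phi> (\<lambda>z. z ^ n)))\<^sup>2) \<le> C" for M
  proof (rule H2_bounded_family(2))
    fix z :: complex assume z: "z \<in> ball 0 1"
    have "(\<Sum>n<M. (cmod (wcomp v \<phi> (\<lambda>z. z ^ n) z))\<^sup>2) = (cmod (v z))\<^sup>2 * (\<Sum>n<M. ((cmod (\<phi> z))\<^sup>2) ^ n)"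
      by (simp add: wcomp_def norm_mult norm_power power_mult_distrib sum_distrib_left power_mult[symmetric] mult.commute)
    also have "\<dots> \<le> (C * (1 - (cmod (\<phi> z))\<^sup>2)) * (1 / (1 - (cmod (\<phi> z))\<^sup>2))"
    proof (rule mult_mono[OF C[OF z]])
      have "(\<Sum>n<M. ((cmod (\<phi> z))\<^sup>2) ^ n) \<le> (\<Sum>n. ((cmod (\<phi> z))\<^sup>2) ^ n)"
        using pos[OF z] by (intro sum_le_suminf summable_geometric) auto
      then show "(\<Sum>n<M. ((cmod (\<phi> z))\<^sup>2) ^ n) \<le> 1 / (1 - (cmod (\<phi> z))\<^sup>2)"
        using pos[OF z] by (simp add: suminf_geometric)
    qed (use pos[OF z] \<open>0 \<le> C\<close> in \<open>auto simp: sum_nonneg\<close>)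
    also have "\<dots> = C" using pos[OF z] by simp
    finally show "(\<Sum>n<M. (cmod (wcomp v \<phi> (\<lambda>z. z ^ n) z))\<^sup>2) \<le> C" .
  qed (auto intro: hol H2_power)
  then have "summable (\<lambda>n. (h2_norm (wcomp v \<phi> (\<lambda>z. z ^ n)))\<^sup>2)"
    by (intro bounded_imp_summable[of _ C]) (auto simp: lessThan_Suc_atMost[symmetric] simp del: sum.lessThan_Suc)
  with op show ?thesis by (simp add: hilbert_schmidt_def)
qed

section \<open>Construction of the new weight\<close>

theorem theorem4p5:
  fixes \<phi> :: "complex \<Rightarrow> complex" and p :: real
  assumes "\<phi> holomorphic_on ball 0 1" and "\<phi> ` ball 0 1 \<subseteq> ball 0 1"
    and "0 < p"
    and "\<exists>w\<in>H2. (\<exists>z\<in>ball 0 1. w z \<noteq> 0) \<and> schatten p (wcomp w \<phi>)"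
  shows "\<exists>w'\<in>H2. (\<exists>z\<in>ball 0 1. w' z \<noteq> 0) \<and> hilbert_schmidt (wcomp w' \<phi>)"
proof -
  obtain w z0 where w: "w \<in> H2" "z0 \<in> ball 0 1" "w z0 \<noteq> 0" and sch: "schatten p (wcomp w \<phi>)"
    using assms(4) by blast
  define T where "T = wcomp w \<phi>"
  have T: "h2_bounded_op T" using sch by (simp add: T_def schatten_def)
  obtain A \<theta> where "0 < A" and \<theta>: "0 < \<theta>" "\<theta> < 1"
    and decay: "\<And>i. (\<Sum>n<4 ^ i. (h2_norm (T (\<lambda>z. z ^ n)))\<^sup>2) \<le> A * (4 * \<theta>) ^ i"
    using schatten_sum_norm_basis_decay[OF sch \<open>0 < p\<close>] unfolding T_def by blast
  \<comment> \<open>The square root divides the gain \<open>\<theta> ^ i\<close> in two: with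
    \<open>c i = (4 * q) ^ (- i)\<close> one factor \<open>q ^ i\<close> makes the series converge,
    and the other makes \<open>c i * 4 ^ i = q ^ (- i)\<close> grow.\<close>
  define q where "q = sqrt \<theta>"
  have q: "0 < q" "q < 1" "q\<^sup>2 = \<theta>" using \<theta> by (auto simp: q_def)
  define c where "c i = inverse ((4 * q) ^ i)" for i :: nat
  have c_pos: "0 < c i" for i using q by (simp add: c_def)
  have "summable (\<lambda>i. c i * (\<Sum>n<4 ^ i. (h2_norm (T (\<lambda>z. z ^ n)))\<^sup>2))"
  proof (rule summable_comparison_test)
    show "summable (\<lambda>i. A * q ^ i)" using q by (intro summable_mult summable_geometric) auto
    have "norm (c i * (\<Sum>n<4 ^ i. (h2_norm (T (\<lambda>z. z ^ n)))\<^sup>2)) \<le> A * q ^ i" for i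
    proof -
      have "c i * (\<Sum>n<4 ^ i. (h2_norm (T (\<lambda>z. z ^ n)))\<^sup>2) \<le> c i * (A * (4 * \<theta>) ^ i)"
        using c_pos[of i] by (intro mult_left_mono decay) auto
      also have "(4 * \<theta>) ^ i = (4 * q) ^ i * q ^ i"
        unfolding q(3)[symmetric] by (simp add: power_mult_distrib power2_eq_square)
      also have "c i * (A * ((4 * q) ^ i * q ^ i)) = A * q ^ i"
        using q by (simp add: c_def field_simps)
      finally show ?thesis using c_pos[of i] by (simp add: sum_nonneg)
    qed
    then show "\<exists>N. \<forall>i\<ge>N. norm (c i * (\<Sum>n<4 ^ i. (h2_norm (T (\<lambda>z. z ^ n)))\<^sup>2)) \<le> A * q ^ i" by blast
  qed
  from holomorphic_majorant[OF finite_lessThan bounded_op_H2[OF T H2_power] less_imp_le[OF c_pos] this]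
  obtain G where G: "G holomorphic_on ball 0 1"
    and maj: "\<And>i z. z \<in> ball 0 1 \<Longrightarrow> c i * (\<Sum>n<4 ^ i. (cmod (T (\<lambda>z. z ^ n) z))\<^sup>2) \<le> Re (G z)"
    by blast
  \<comment> \<open>The k-th power raises the growth \<open>q ^ (- i)\<close> to at least
    \<open>4 ^ i\<close>, which is the order of \<open>1 / (1 - x)\<close> at the chosen
    scale.\<close>
  obtain k where k: "q ^ k < 1 / 4"
    using real_arch_pow_inv[of "1 / 4" q] q by auto
  \<comment> \<open>The exponential never vanishes, so \<open>v\<close> is nonzero wherever
    \<open>w\<close> is. Its squared modulus \<open>exp (- u)\<close>, with
    \<open>u = 2 * Re (G z)\<close>, will absorb the power \<open>u ^ k\<close>.\<close>
  define v where "v z = w z ^ k * exp (- G z)" for z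
  have v: "v holomorphic_on ball 0 1"
    unfolding v_def by (intro holomorphic_intros G H2_holomorphic w)
  have v_le: "(cmod (v z))\<^sup>2 \<le> 4 * fact k * (1 - (cmod (\<phi> z))\<^sup>2)" if z: "z \<in> ball 0 1" for z
  proof -
    define x where "x = (cmod (\<phi> z))\<^sup>2"
    define u where "u = 2 * Re (G z)"
    have x: "0 \<le> x" "x < 1"
      using assms(2) z by (auto simp: x_def image_subset_iff abs_square_less_1)
    obtain i where i: "4 ^ i * (1 - x) \<le> 1" "1 < 4 ^ Suc i * (1 - x)"
      using scale_selection[OF x] by blast
    \<comment> \<open>At scale \<open>i\<close> the geometric sum is at least
      \<open>4 ^ i / 2\<close>, so the majorant property for this \<open>i\<close> alone gives the
      bound.\<close>
    have "(cmod (w z))\<^sup>2 * inverse q ^ i \<le> u"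
    proof -
      have "(cmod (w z))\<^sup>2 * inverse q ^ i = 2 * (c i * ((cmod (w z))\<^sup>2 * (real (4 ^ i) / 2)))"
        by (simp add: c_def power_mult_distrib power_inverse field_simps)
      also have "\<dots> \<le> 2 * (c i * ((cmod (w z))\<^sup>2 * (\<Sum>n<4 ^ i. x ^ n)))"
        using i(1) x c_pos[of i] by (intro mult_left_mono geometric_sum_ge_half) auto
      also have "(cmod (w z))\<^sup>2 * (\<Sum>n<4 ^ i. x ^ n) = (\<Sum>n<4 ^ i. (cmod (T (\<lambda>z. z ^ n) z))\<^sup>2)"
        by (simp add: T_def wcomp_def norm_mult norm_power power_mult_distrib sum_distrib_left x_def
            power_mult[symmetric] mult.commute)
      also have "2 * (c i * \<dots>) \<le> u" using maj[OF z, of i] by (simp add: u_def)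
      finally show ?thesis .
    qed
    moreover have base: "0 \<le> (cmod (w z))\<^sup>2 * inverse q ^ i" using q by simp
    ultimately have u: "0 \<le> u" "((cmod (w z))\<^sup>2 * inverse q ^ i) ^ k \<le> u ^ k"
      by (auto intro: power_mono)
    have "4 ^ i \<le> (inverse q ^ i) ^ k"
    proof -
      have "4 \<le> inverse q ^ k" using k q by (simp add: power_inverse field_simps)
      then have "4 ^ i \<le> (inverse q ^ k) ^ i" by (rule power_mono) simp
      then show ?thesis by (simp add: power_mult[symmetric] mult.commute)
    qed
    then have "((cmod (w z))\<^sup>2) ^ k * 4 ^ i \<le> u ^ k"
      using order_trans[OF mult_left_mono u(2)[unfolded power_mult_distrib], of "4 ^ i"] by simp
    then have "((cmod (w z))\<^sup>2) ^ k * 4 ^ i * (4 * (1 - x)) \<le> u ^ k * (4 * (1 - x))"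
      using x by (intro mult_right_mono) auto
    \<comment> \<open>The upper half of the scale selection, \<open>1 < 4 ^ Suc i * (1 - x)\<close>,
      trades \<open>4 ^ i\<close> for the factor \<open>4 * (1 - x)\<close>.\<close>
    moreover have "((cmod (w z))\<^sup>2) ^ k \<le> ((cmod (w z))\<^sup>2) ^ k * (4 ^ i * (4 * (1 - x)))"
      using i(2) mult_left_mono[of 1 "4 ^ i * (4 * (1 - x))" "((cmod (w z))\<^sup>2) ^ k"]
      by (simp add: algebra_simps)
    ultimately have wk: "((cmod (w z))\<^sup>2) ^ k \<le> u ^ k * (4 * (1 - x))" by (simp add: mult.assoc)
    \<comment> \<open>A single term of the exponential series; multiplying by
      \<open>exp (- u)\<close> then leaves only the constant \<open>4 * fact k\<close> and the
      factor \<open>1 - x\<close>.\<close>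
    have "u ^ k \<le> fact k * exp u"
      using power_div_fact_le_exp[OF u(1), of k] by (simp add: field_simps)
    then have "u ^ k * (4 * (1 - x)) \<le> fact k * exp u * (4 * (1 - x))"
      using x by (intro mult_right_mono) auto
    with wk have "((cmod (w z))\<^sup>2) ^ k * exp (- u) \<le> fact k * exp u * (4 * (1 - x)) * exp (- u)"
      by (intro mult_right_mono) auto
    moreover have "(cmod (v z))\<^sup>2 = ((cmod (w z))\<^sup>2) ^ k * exp (- u)"
      by (simp add: v_def u_def norm_mult norm_power power_mult_distrib power_mult[symmetric] mult.commute
          exp_double[symmetric])
    moreover have "fact k * exp u * (4 * (1 - x)) * exp (- u) = 4 * fact k * (1 - x)"
      by (simp add: exp_minus)
    ultimately show ?thesis by (simp only: x_def)
  qed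
  have "(cmod (v z))\<^sup>2 \<le> 4 * fact k" if "z \<in> ball 0 1" for z
    using v_le[OF that] by (rule order_trans) (simp add: mult_left_le)
  then have "v \<in> H2"
    using H2_bounded_family[of "{()}" "\<lambda>_. v" "4 * fact k"] v by simp
  moreover have "v z0 \<noteq> 0" using w by (simp add: v_def)
  moreover have "hilbert_schmidt (wcomp v \<phi>)"
    using hilbert_schmidt_wcomp[OF assms(1,2) v v_le] .
  ultimately show ?thesis using w(2) by blast
qed

end
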